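(* Let $c>0$ and $\delta>0$. For any non-negative integer $k$, $$\mathcal{C}_\delta(u,k)\sim \mathcal{B}_{2c^2\delta}(k)\,\psi_\infty(u),\qquad u\to\infty.$$
   Context: $B$ is a standard Brownian motion and $c>0$ is a fixed constant. For $\delta>0$, $G(\delta)=\{0,\delta,2\delta,\ldots\}$; for $\alpha>0$, $\alpha\mathbb{Z}=\{\alpha k:k\in\mathbb{Z}\}$. The symbol $\#$ stands for the number of elements of a set, and $\mathbb{I}(\cdot)$ is the indicator function. Cumulative Parisian ruin probability on the grid: for $u>0$ and a non-negative integer $k$, $$\mathcal{C}_\delta(u,k)=\mathbb{P}\left\{\#\{t\in G(\delta):B(t)-ct>u\}>k\right\}.$$ $\psi_\infty(u)=\mathbb{P}\{\sup_{t\ge0}(B(t)-ct)>u\}=e^{-2cu}$. For $\eta>0$ define $$\mathcal{B}_\eta(k)=\lim_{S\to\infty}\frac{\mathcal{B}_\eta(S,k)}{S}\in(0,\infty),$$ where for $S>0$ $$\mathcal{B}_\eta(S,k)=\int_{\mathbb{R}}\mathbb{P}\left\{\sum_{s\in[0,S]\cap\eta\mathbb{Z}}\mathbb{I}\big(\sqrt2B(s)-|s|+z>0\big)>k\right\}e^{-z}\,dz.$$ $f(u)\sim g(u)$ as $u\to\infty$ means $f(u)/g(u)\to1$. *)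

theory Defs
  imports
    "HOL-Probability.Probability"
    "HOL-Library.Extended_Nat"
    "HOL-Library.Landau_Symbols"
begin

text \<open>
  The process is indexed by all reals, but only its restriction to \<open>t \<ge> 0\<close> is constrained or used.
  Every path is continuous, not just almost every path; hence an event such as
  \<open>sup\<^sub>t (B t - c * t) > u\<close> is measurable although the supremum is over an uncountable set.
\<close>
locale standard_brownian_motion = prob_space M
  for M :: "'a measure" and B :: "real \<Rightarrow> 'a \<Rightarrow> real" +
  assumes random_variable_B: "\<And>t. 0 \<le> t \<Longrightarrow> random_variable borel (B t)"
    and start_zero: "AE \<omega> in M. B 0 \<omega> = 0"
    and independent_increments:
      "\<And>(t :: nat \<Rightarrow> real) n. 0 \<le> t 0 \<Longrightarrow> (\<And>i. i < n \<Longrightarrow> t i < t (Suc i)) \<Longrightarrow>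
         indep_vars (\<lambda>_. borel) (\<lambda>i \<omega>. B (t (Suc i)) \<omega> - B (t i) \<omega>) {..<n}"
    and normal_increments:
      "\<And>s t. 0 \<le> s \<Longrightarrow> s < t \<Longrightarrow>
         distributed M lborel (\<lambda>\<omega>. B t \<omega> - B s \<omega>) (normal_density 0 (sqrt (t - s)))"
    and continuous_paths: "\<And>\<omega>. \<omega> \<in> space M \<Longrightarrow> continuous_on {0..} (\<lambda>t. B t \<omega>)"

text \<open>Unlike \<^const>\<open>card\<close>, this gives \<open>\<infinity>\<close> on infinite sets.\<close>
definition num_elems :: "'b set \<Rightarrow> enat" where
  "num_elems A = (if finite A then enat (card A) else \<infinity>)"

definition grid :: "real \<Rightarrow> real set" where
  "grid \<delta> = {\<delta> * real n | n. True}"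

definition lattice_pts :: "real \<Rightarrow> real set" where
  "lattice_pts \<alpha> = {\<alpha> * real_of_int j | j. True}"

definition cumulative_parisian ::
  "'a measure \<Rightarrow> (real \<Rightarrow> 'a \<Rightarrow> real) \<Rightarrow> real \<Rightarrow> real \<Rightarrow> real \<Rightarrow> nat \<Rightarrow> real" where
  "cumulative_parisian M B c \<delta> u k =
     \<P>(\<omega> in M. num_elems {t \<in> grid \<delta>. B t \<omega> - c * t > u} > enat k)"

text \<open>The supremum is taken in the extended reals, since a path may be unbounded (on a null set).\<close>
definition ruin_prob :: "'a measure \<Rightarrow> (real \<Rightarrow> 'a \<Rightarrow> real) \<Rightarrow> real \<Rightarrow> real \<Rightarrow> real" where
  "ruin_prob M B c u = \<P>(\<omega> in M. (SUP t\<in>{0..}. ereal (B t \<omega> - c * t)) > ereal u)"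

definition berman_integral ::
  "'a measure \<Rightarrow> (real \<Rightarrow> 'a \<Rightarrow> real) \<Rightarrow> real \<Rightarrow> real \<Rightarrow> nat \<Rightarrow> real" where
  "berman_integral M B \<eta> S k =
     (LINT z|lborel.
        \<P>(\<omega> in M. (\<Sum>s\<in>{0..S} \<inter> lattice_pts \<eta>.
                     of_bool (sqrt 2 * B s \<omega> - \<bar>s\<bar> + z > 0)) > k) * exp (- z))"

definition berman_const ::
  "'a measure \<Rightarrow> (real \<Rightarrow> 'a \<Rightarrow> real) \<Rightarrow> real \<Rightarrow> nat \<Rightarrow> real" where
  "berman_const M B \<eta> k = Lim at_top (\<lambda>S. berman_integral M B \<eta> S k / S)"

end

theory Submission
  imports Defs
begin

text \<open>
  Put \<open>\<eta> = 2 c\<^sup>2 \<delta>\<close>. Both \<open>2 c (B (\<delta> n) - c \<delta> n)\<close> and \<open>\<surd>2 B (\<eta> n) - \<eta> n\<close> are Gaussian random walks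
  \<open>X\<close> with steps \<open>N (-\<eta>, 2 \<eta>)\<close>, for which \<open>exp X\<close> is a martingale. A path exceeds the level \<open>x\<close>
  more than \<open>k\<close> times iff there is a (necessarily unique) time \<open>m\<close> with \<open>X m > x\<close> and exactly \<open>k\<close>
  exceedances afterwards. With \<open>q w\<close> the probability that exactly \<open>k\<close> of \<open>X 1, X 2, ...\<close> exceed
  \<open>-w\<close>, summation over \<open>m\<close> gives
  \<open>exp x * P (more than k exceedances of x) = \<integral>\<^sub>0\<^sup>\<infinity> q w exp (-w) u (x + w) dw\<close>,
  where \<open>u\<close> is the renewal density of the tilted walk, an explicit Gaussian sum tending to \<open>1 / \<eta>\<close>.
  For finitely many steps the same decomposition, integrated over \<open>x\<close> against \<open>exp x\<close>, shows that
  the Berman integral is a sum of integrals \<open>\<kappa>\<^sub>l\<close> converging to \<open>\<kappa> = \<integral>\<^sub>0\<^sup>\<infinity> q w exp (-w) dw\<close>, so the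
  Berman constant is the Cesaro limit \<open>\<kappa> / \<eta>\<close>. Finally \<open>\<psi>\<^sub>\<infinity> u = exp (-2 c u)\<close> is obtained from dyadic
  grids, on which the mean exponential overshoot tends to \<open>1\<close> as the mesh shrinks.
\<close>

section \<open>The Gaussian renewal density\<close>

definition Phi :: "real \<Rightarrow> real" where
  "Phi = cdf std_normal_distribution"

lemma Phi_diff:
  assumes "a \<le> b"
  shows "Phi b - Phi a = integral {a..b} std_normal_density"
proof -
  interpret real_distribution std_normal_distribution
    by (rule real_dist_normal_dist)
  have "Phi b - Phi a = measure std_normal_distribution {a<..b}"
  proof (cases "a = b")
    case False
    then show ?thesis unfolding Phi_def using cdf_diff_eq[of a b] assms by simp
  qed simp
  also have "\<dots> = (LINT x|lborel. indicator {a<..b} x * std_normal_density x)"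
    by (simp add: measure_density_const measure_def emeasure_density integral_eq_nn_integral ennreal_mult'
        ennreal_indicator mult.commute)
  also have "\<dots> = (LINT x|lborel. indicator {a..b} x * std_normal_density x)"
    by (intro integral_cong_AE) (auto intro!: AE_I[of _ _ "{a}"] simp: indicator_def)
  also have "\<dots> = integral {a..b} std_normal_density"
    by (subst set_borel_integral_eq_integral(2)[symmetric])
       (auto simp: set_lebesgue_integral_def set_integrable_def intro!: integrable_mult_indicator[where 'b=real, simplified])
  finally show ?thesis .
qed

lemma has_derivative_Phi: "(Phi has_real_derivative std_normal_density x) (at x)"
proof -
  \<comment> \<open>On a fixed window around \<open>x\<close> the fundamental theorem of calculus
    applies, and \<open>Phi_diff\<close> identifies the integral with \<open>Phi\<close> up to the
    constant \<open>Phi (x-1)\<close>.\<close>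
  have c: "continuous_on {x-1..x+1} std_normal_density"
    unfolding normal_density_def by (intro continuous_intros) auto
  have "((\<lambda>u. integral {x-1..u} std_normal_density) has_real_derivative std_normal_density x)
          (at x within {x-1..x+1})"
    by (rule integral_has_real_derivative[OF c]) auto
  then have "((\<lambda>u. integral {x-1..u} std_normal_density) has_real_derivative std_normal_density x) (at x)"
    by (simp add: at_within_Icc_at)
  then have "((\<lambda>u. Phi (x-1) + integral {x-1..u} std_normal_density) has_real_derivative std_normal_density x) (at x)"
    by (auto intro!: derivative_eq_intros)
  then show ?thesis
  proof (rule has_field_derivative_transform_within_open)
    show "open {x-1<..<x+1}" by auto
    fix u assume "u \<in> {x-1<..<x+1}"
    then show "Phi (x-1) + integral {x-1..u} std_normal_density = Phi u"
      using Phi_diff[of "x-1" u] by auto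
  qed auto
qed

lemma isCont_Phi: "isCont Phi x"
  by (rule DERIV_isCont[OF has_derivative_Phi])

lemma Phi_at_top: "(Phi \<longlongrightarrow> 1) at_top" and Phi_at_bot: "(Phi \<longlongrightarrow> 0) at_bot"
proof -
  interpret real_distribution std_normal_distribution
    by (rule real_dist_normal_dist)
  show "(Phi \<longlongrightarrow> 1) at_top" "(Phi \<longlongrightarrow> 0) at_bot"
    unfolding Phi_def by (simp_all add: cdf_lim_at_top_prob cdf_lim_at_bot)
qed

text \<open>On each cell the sum differs from the increment of \<open>F\<close> by at most the mesh
  times the variation of \<open>f\<close> there. A function that rises from 0 to \<open>f p\<close>
  and then falls while staying nonnegative has total variation at most
  \<open>2 * f p\<close>.\<close>

lemma unimodal_riemann_sum:
  fixes f F :: "real \<Rightarrow> real"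
  assumes \<eta>: "0 < \<eta>" and p: "0 \<le> p"
    and F_cont: "continuous_on {0..} F"
    and F_deriv: "\<And>s. 0 < s \<Longrightarrow> (F has_real_derivative f s) (at s)"
    and F0: "F 0 = 0" and F_lim: "(F \<longlongrightarrow> 1) at_top"
    and f_nonneg: "\<And>s. 0 \<le> s \<Longrightarrow> 0 \<le> f s" and f0: "f 0 = 0"
    and f_mono: "\<And>s t. 0 \<le> s \<Longrightarrow> s \<le> t \<Longrightarrow> t \<le> p \<Longrightarrow> f s \<le> f t"
    and f_anti: "\<And>s t. p \<le> s \<Longrightarrow> s \<le> t \<Longrightarrow> f t \<le> f s"
  shows "summable (\<lambda>n. f (\<eta> * real n))" and "\<bar>\<eta> * (\<Sum>n. f (\<eta> * real n)) - 1\<bar> \<le> 2 * \<eta> * f p"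
proof -
  \<comment> \<open>The variation of \<open>f\<close> over the interval from 0 to
    \<open>s\<close>.\<close>
  define V where "V s = (if s \<le> p then f s else 2 * f p - f s)" for s
  have V: "\<bar>f t - f s\<bar> \<le> V t - V s" "V s \<le> V t" if "0 \<le> s" "s \<le> t" for s t
    using that f_mono[of s t] f_mono[of s p] f_anti[of p t] f_anti[of s t] p
    unfolding V_def by (auto split: if_splits)
  have V_le: "V s \<le> 2 * f p" if "0 \<le> s" for s
    using that f_mono[of s p] f_nonneg[of s] f_nonneg[of p] p unfolding V_def by auto
  have V0: "V 0 = 0" using f0 p by (simp add: V_def)
  have step: "\<bar>F (\<eta> * real (Suc n)) - F (\<eta> * real n) - \<eta> * f (\<eta> * real n)\<bar>
       \<le> \<eta> * (V (\<eta> * real (Suc n)) - V (\<eta> * real n))" for n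
  proof -
    have lt: "\<eta> * real n < \<eta> * real (Suc n)" and n0: "0 \<le> \<eta> * real n" using \<eta> by auto
    \<comment> \<open>The mean value theorem asks for differentiability only inside the cell, so the
      first cell, where \<open>F\<close> is merely continuous at 0, is covered too.\<close>
    have "\<exists>z. \<eta> * real n < z \<and> z < \<eta> * real (Suc n) \<and>
        F (\<eta> * real (Suc n)) - F (\<eta> * real n) = (\<eta> * real (Suc n) - \<eta> * real n) * f z"
    proof -
      have "\<exists>l z. \<eta> * real n < z \<and> z < \<eta> * real (Suc n) \<and> DERIV F z :> l \<and>
        F (\<eta> * real (Suc n)) - F (\<eta> * real n) = (\<eta> * real (Suc n) - \<eta> * real n) * l"
      proof (rule MVT[OF lt])
      show "continuous_on {\<eta> * real n..\<eta> * real (Suc n)} F"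
        using F_cont by (rule continuous_on_subset) (use n0 in auto)
    next
      fix x assume x: "\<eta> * real n < x"
      then show "F differentiable (at x)"
        using F_deriv[of x] n0 real_differentiable_def by auto
      qed
      then show ?thesis using DERIV_unique[OF _ F_deriv] n0 by (metis le_less_trans)
    qed
    then obtain z where z: "\<eta> * real n < z" "z < \<eta> * real (Suc n)"
      "F (\<eta> * real (Suc n)) - F (\<eta> * real n) = \<eta> * f z"
      by (auto simp: algebra_simps)
    have "\<bar>f z - f (\<eta> * real n)\<bar> \<le> V (\<eta> * real (Suc n)) - V (\<eta> * real n)"
      using V[of "\<eta> * real n" z] V[of z "\<eta> * real (Suc n)"] z n0 by auto
    then have "\<bar>\<eta> * (f z - f (\<eta> * real n))\<bar> \<le> \<eta> * (V (\<eta> * real (Suc n)) - V (\<eta> * real n))"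
      using \<eta> by (simp add: abs_mult)
    then show ?thesis using z(3) by (simp add: algebra_simps)
  qed
  have part: "\<bar>F (\<eta> * real N) - \<eta> * (\<Sum>n<N. f (\<eta> * real n))\<bar> \<le> \<eta> * V (\<eta> * real N)" for N
  proof (induction N)
    case (Suc N)
    then show ?case using step[of N] by (simp add: algebra_simps)
  qed (simp add: F0 V0)
  have part': "\<bar>F (\<eta> * real N) - \<eta> * (\<Sum>n<N. f (\<eta> * real n))\<bar> \<le> 2 * \<eta> * f p" for N
  proof -
    have "\<eta> * V (\<eta> * real N) \<le> \<eta> * (2 * f p)"
      using \<eta> by (intro mult_left_mono V_le) auto
    then show ?thesis using part[of N] by linarith
  qed
  have Flim: "(\<lambda>N. F (\<eta> * real N)) \<longlonglongrightarrow> 1"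
    by (rule filterlim_compose[OF F_lim]) (use \<eta> in real_asymp)
  \<comment> \<open>Boundedness of \<open>F\<close> along the grid turns the error estimate into a
    bound on the partial sums, whose terms are nonnegative.\<close>
  then have "Bseq (\<lambda>N. F (\<eta> * real N))" by (intro convergent_imp_Bseq convergentI)
  then obtain K where K: "\<And>N. \<bar>F (\<eta> * real N)\<bar> \<le> K" unfolding Bseq_def by auto
  have "(\<Sum>n<N. f (\<eta> * real n)) \<le> (K + 2 * \<eta> * f p) / \<eta>" for N
    using part'[of N] K[of N] \<eta> by (simp add: field_simps abs_le_iff)
  then show s: "summable (\<lambda>n. f (\<eta> * real n))"
    by (intro summableI_nonneg_bounded[where x="(K + 2 * \<eta> * f p) / \<eta>"]) (use f_nonneg \<eta> in auto)
  have "(\<lambda>N. \<bar>F (\<eta> * real N) - \<eta> * (\<Sum>n<N. f (\<eta> * real n))\<bar>) \<longlonglongrightarrow> \<bar>1 - \<eta> * (\<Sum>n. f (\<eta> * real n))\<bar>"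
    by (intro tendsto_intros Flim summable_LIMSEQ s)
  then have "\<bar>1 - \<eta> * (\<Sum>n. f (\<eta> * real n))\<bar> \<le> 2 * \<eta> * f p"
    by (rule tendsto_upperbound) (use part' in auto)
  then show "\<bar>\<eta> * (\<Sum>n. f (\<eta> * real n)) - 1\<bar> \<le> 2 * \<eta> * f p" by (simp add: abs_minus_commute)
qed

text \<open>The density at \<open>y\<close> of the normal law with mean \<open>s\<close> and
  variance \<open>2 * s\<close>. Division by zero gives the value 0 at \<open>s = 0\<close>, so the
  term \<open>n = 0\<close> drops out of all sums below.\<close>

definition gauss_kernel :: "real \<Rightarrow> real \<Rightarrow> real" where
  "gauss_kernel y s = exp (- (y - s)\<^sup>2 / (4 * s)) / sqrt (4 * pi * s)"

text \<open>A closed form for the integral of the kernel over the time variable. It has the shape of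
  an inverse Gaussian distribution function, but with a minus sign in front of the reflected
  term.\<close>

definition gauss_kernel_primitive :: "real \<Rightarrow> real \<Rightarrow> real" where
  "gauss_kernel_primitive y s = Phi ((s - y) / sqrt (2 * s)) - exp y * Phi (- (s + y) / sqrt (2 * s))"

text \<open>After multiplication by \<open>exp y\<close> the reflected Gaussian density equals the
  first one, so the derivative is this common density times the difference of the two inner
  derivatives, which is \<open>1 / r\<close>.\<close>

lemma gauss_kernel_primitive_deriv:
  assumes s: "0 < s"
  shows "(gauss_kernel_primitive y has_real_derivative gauss_kernel y s) (at s)"
proof -
  define r where "r = sqrt (2 * s)"
  have r: "0 < r" "r\<^sup>2 = 2 * s" using s by (auto simp: r_def)
  have s': "s = r\<^sup>2 / 2" using r by simp
  let ?p = "std_normal_density ((s - y) / r)" and ?q = "std_normal_density (- (s + y) / r)"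
  have g: "gauss_kernel y s = ?p / r"
  proof -
    have e: "(y - s)\<^sup>2 / (4 * s) = ((s - y) / r)\<^sup>2 / 2"
      using r s by (simp add: power_divide power2_commute)
    have "sqrt (4 * pi * s) = sqrt (2 * pi) * r" unfolding r_def
      by (subst real_sqrt_mult[symmetric]) (simp add: algebra_simps)
    then show ?thesis using e by (simp add: gauss_kernel_def std_normal_density_def)
  qed
  have pq: "exp y * ?q = ?p"
  proof -
    have "y + - (- (s + y) / r)\<^sup>2 / 2 = - ((s - y) / r)\<^sup>2 / 2"
      using s by (simp add: power_divide r(2)) (simp add: field_simps power2_eq_square)
    then show ?thesis by (simp add: std_normal_density_def exp_add[symmetric])
  qed
  have rd: "((\<lambda>s. sqrt (2 * s)) has_real_derivative (1 / r)) (at s)"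
    using s unfolding r_def by (auto intro!: derivative_eq_intros simp: field_simps)
  have d1: "((\<lambda>s. (s - y) / sqrt (2 * s)) has_real_derivative (r - (s - y) * (1 / r)) / (r * r)) (at s)"
    using DERIV_divide[OF DERIV_diff[OF DERIV_ident DERIV_const[of y]] rd] r by (simp add: r_def)
  have d2: "((\<lambda>s. - (s + y) / sqrt (2 * s)) has_real_derivative (- r + (s + y) * (1 / r)) / (r * r)) (at s)"
    by (rule DERIV_cong[OF DERIV_divide[OF DERIV_minus[OF DERIV_add[OF DERIV_ident DERIV_const[of y]]] rd]])
       (use r in \<open>auto simp: r_def[symmetric] add_divide_distrib diff_divide_distrib\<close>)
  have pq': "exp y * (?q * z) = ?p * z" for z
    by (simp only: mult.assoc[symmetric] pq)
  have eq: "?p * ((r - (s - y) * (1 / r)) / (r * r)) - exp y * (?q * ((- r + (s + y) * (1 / r)) / (r * r)))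
      = gauss_kernel y s"
  proof -
    have "(r - (s - y) * (1 / r)) / (r * r) - (- r + (s + y) * (1 / r)) / (r * r) = 1 / r"
      using r s' by (simp add: field_simps power2_eq_square)
    then show ?thesis unfolding pq' right_diff_distrib[symmetric] using g by simp
  qed
  show ?thesis
    unfolding gauss_kernel_primitive_def
    by (rule DERIV_cong[OF DERIV_diff[OF DERIV_chain2[OF has_derivative_Phi d1]
          DERIV_cmult[OF DERIV_chain2[OF has_derivative_Phi d2]]]])
       (use eq in \<open>simp add: r_def\<close>)
qed

lemma gauss_kernel_primitive_at_0:
  assumes "0 < y"
  shows "(gauss_kernel_primitive y \<longlongrightarrow> 0) (at_right 0)"
proof -
  have 1: "filterlim (\<lambda>s. (s - y) / sqrt (2 * s)) at_bot (at_right 0)"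
    using assms by real_asymp
  have 2: "filterlim (\<lambda>s. - (s + y) / sqrt (2 * s)) at_bot (at_right 0)"
    using assms by real_asymp
  have "((\<lambda>s. Phi ((s - y) / sqrt (2 * s)) - exp y * Phi (- (s + y) / sqrt (2 * s))) \<longlongrightarrow> 0 - exp y * 0) (at_right 0)"
    by (intro tendsto_intros filterlim_compose[OF Phi_at_bot] 1 2)
  then show ?thesis by (simp add: gauss_kernel_primitive_def[abs_def])
qed

lemma gauss_kernel_primitive_at_top: "(gauss_kernel_primitive y \<longlongrightarrow> 1) at_top"
proof -
  have 1: "filterlim (\<lambda>s. (s - y) / sqrt (2 * s)) at_top at_top"
    by real_asymp
  have 2: "filterlim (\<lambda>s. - (s + y) / sqrt (2 * s)) at_bot at_top"
    by real_asymp
  have "((\<lambda>s. Phi ((s - y) / sqrt (2 * s)) - exp y * Phi (- (s + y) / sqrt (2 * s))) \<longlongrightarrow> 1 - exp y * 0) at_top"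
    by (intro tendsto_intros filterlim_compose[OF Phi_at_bot] filterlim_compose[OF Phi_at_top] 1 2)
  then show ?thesis by (simp add: gauss_kernel_primitive_def[abs_def])
qed

lemma gauss_kernel_nonneg: "0 \<le> s \<Longrightarrow> 0 \<le> gauss_kernel y s"
  by (simp add: gauss_kernel_def)

lemma gauss_kernel_0 [simp]: "gauss_kernel y 0 = 0"
  by (simp add: gauss_kernel_def)

text \<open>The derivative is written so that its sign can be read off from
  \<open>y\<^sup>2 - 2 * s - s\<^sup>2\<close>.\<close>

lemma gauss_kernel_deriv:
  assumes s: "0 < s"
  shows "(gauss_kernel y has_real_derivative gauss_kernel y s * ((y\<^sup>2 - 2 * s - s\<^sup>2) / (4 * s\<^sup>2))) (at s)"
proof -
  have d1: "((\<lambda>s. - (y - s)\<^sup>2 / (4 * s)) has_real_derivative (y\<^sup>2 - s\<^sup>2) / (4 * s\<^sup>2)) (at s)"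
    using s by (auto intro!: derivative_eq_intros simp: field_simps power2_eq_square)
  have "((\<lambda>s. sqrt (4 * pi * s)) has_real_derivative (4 * pi) * (inverse (sqrt (4 * pi * s)) / 2)) (at s)"
    using DERIV_chain2[OF DERIV_real_sqrt DERIV_cmult[OF DERIV_ident], of "4 * pi" s] s by (simp add: mult_ac)
  also have "(4 * pi) * (inverse (sqrt (4 * pi * s)) / 2) = sqrt (4 * pi * s) / (2 * s)"
  proof -
    have "(4 * pi) * (inverse q / 2) = q / (2 * s)" if "q > 0" "q * q = 4 * pi * s" for q
      using that s by (simp add: field_simps)
    from this[of "sqrt (4 * pi * s)"] show ?thesis using s by simp
  qed
  finally have d2: "((\<lambda>s. sqrt (4 * pi * s)) has_real_derivative sqrt (4 * pi * s) / (2 * s)) (at s)" .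
  have alg: "(e * a * q - e * (q / (2 * s))) / (q * q) = e / q * (a - 1 / (2 * s))" if "q > 0" for e a q :: real
    using that s by (simp add: field_simps)
  have "(y\<^sup>2 - s\<^sup>2) / (4 * s\<^sup>2) - 1 / (2 * s) = (y\<^sup>2 - 2 * s - s\<^sup>2) / (4 * s\<^sup>2)"
    using s by (simp add: field_simps power2_eq_square)
  then have eq: "(exp (- (y - s)\<^sup>2 / (4 * s)) * ((y\<^sup>2 - s\<^sup>2) / (4 * s\<^sup>2)) * sqrt (4 * pi * s)
       - exp (- (y - s)\<^sup>2 / (4 * s)) * (sqrt (4 * pi * s) / (2 * s))) / (sqrt (4 * pi * s) * sqrt (4 * pi * s))
      = gauss_kernel y s * ((y\<^sup>2 - 2 * s - s\<^sup>2) / (4 * s\<^sup>2))"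
    unfolding gauss_kernel_def by (subst alg) (use s in auto)
  show ?thesis
    unfolding gauss_kernel_def[abs_def]
    by (rule DERIV_cong[OF DERIV_divide[OF DERIV_chain2[OF DERIV_exp d1] d2]])
       (use s eq in \<open>auto simp: gauss_kernel_def\<close>)
qed

text \<open>The nonnegative root of \<open>s\<^sup>2 + 2 * s = y\<^sup>2\<close>, where the
  derivative of the kernel changes sign.\<close>

definition gauss_kernel_peak :: "real \<Rightarrow> real" where
  "gauss_kernel_peak y = sqrt (y\<^sup>2 + 1) - 1"

lemma gauss_kernel_peak:
  assumes "0 \<le> s"
  shows "s \<le> gauss_kernel_peak y \<longleftrightarrow> s\<^sup>2 + 2 * s \<le> y\<^sup>2"
proof -
  have "s \<le> gauss_kernel_peak y \<longleftrightarrow> sqrt ((s + 1)\<^sup>2) \<le> sqrt (y\<^sup>2 + 1)"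
    using assms by (auto simp: gauss_kernel_peak_def)
  also have "\<dots> \<longleftrightarrow> (s + 1)\<^sup>2 \<le> y\<^sup>2 + 1" by (rule real_sqrt_le_iff)
  also have "\<dots> \<longleftrightarrow> s\<^sup>2 + 2 * s \<le> y\<^sup>2" by (simp add: power2_eq_square algebra_simps)
  finally show ?thesis .
qed

lemma gauss_kernel_mono:
  assumes "0 \<le> s" "s \<le> t" "t \<le> gauss_kernel_peak y"
  shows "gauss_kernel y s \<le> gauss_kernel y t"
\<comment> \<open>The derivative formula holds for positive times only; at time 0 the kernel is 0
  and lies below all other values.\<close>
proof (cases "s = 0")
  case True
  then show ?thesis using assms gauss_kernel_nonneg[of t y] by simp
next
  case False
  show ?thesis
  proof (rule DERIV_nonneg_imp_nondecreasing[OF assms(2)])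
    fix x assume x: "s \<le> x" "x \<le> t"
    then have x0: "0 < x" using False assms by auto
    have "x\<^sup>2 + 2 * x \<le> y\<^sup>2" using gauss_kernel_peak[of x y] x x0 assms by auto
    then have "0 \<le> gauss_kernel y x * ((y\<^sup>2 - 2 * x - x\<^sup>2) / (4 * x\<^sup>2))"
      using gauss_kernel_nonneg[of x y] x0 by (intro mult_nonneg_nonneg divide_nonneg_nonneg) auto
    then show "\<exists>z. DERIV (gauss_kernel y) x :> z \<and> 0 \<le> z"
      using gauss_kernel_deriv[OF x0, of y] by blast
  qed
qed

lemma gauss_kernel_antimono:
  assumes "gauss_kernel_peak y \<le> s" "s \<le> t" "0 < s"
  shows "gauss_kernel y t \<le> gauss_kernel y s"
proof (rule DERIV_nonpos_imp_nonincreasing[OF assms(2)])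
  fix x assume x: "s \<le> x" "x \<le> t"
  then have x0: "0 < x" using assms by auto
  have "x\<^sup>2 + 2 * x \<ge> y\<^sup>2"
  proof (cases "x = gauss_kernel_peak y")
    case True
    have "(x + 1)\<^sup>2 = y\<^sup>2 + 1" using True by (simp add: gauss_kernel_peak_def)
    then show ?thesis by (simp add: power2_eq_square algebra_simps)
  next
    case False
    then show ?thesis using gauss_kernel_peak[of x y] x x0 assms by auto
  qed
  then have "gauss_kernel y x * ((y\<^sup>2 - 2 * x - x\<^sup>2) / (4 * x\<^sup>2)) \<le> 0"
    using gauss_kernel_nonneg[of x y] x0 by (intro mult_nonneg_nonpos divide_nonpos_nonneg) auto
  then show "\<exists>z. DERIV (gauss_kernel y) x :> z \<and> z \<le> 0"
    using gauss_kernel_deriv[OF x0, of y] by blast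
qed

text \<open>The renewal density \<open>\<Sum>n. gauss_kernel y (\<eta> n)\<close> is a Riemann sum of mesh \<open>\<eta>\<close> for
  \<open>\<integral>\<^sub>0\<^sup>\<infinity> gauss_kernel y s ds = 1\<close>, and the error is controlled by the peak height.\<close>

lemma gauss_kernel_sum:
  assumes \<eta>: "0 < \<eta>" and y: "0 < y"
  shows "summable (\<lambda>n. gauss_kernel y (\<eta> * real n))"
    and "\<bar>\<eta> * (\<Sum>n. gauss_kernel y (\<eta> * real n)) - 1\<bar> \<le> 2 * \<eta> / sqrt (4 * pi * gauss_kernel_peak y)"
proof -
  let ?p = "gauss_kernel_peak y"
  have p: "0 < ?p" using y by (simp add: gauss_kernel_peak_def)
  \<comment> \<open>At \<open>s = 0\<close> the formula for the primitive evaluates, through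
    division by zero, to \<open>Phi 0 - exp y * Phi 0\<close>. The right limit 0 is therefore put in
    by hand, which makes \<open>F\<close> continuous.\<close>
  define F where "F s = (if s \<le> 0 then 0 else gauss_kernel_primitive y s)" for s
  have d: "(F has_real_derivative gauss_kernel y s) (at s)" if "0 < s" for s
    by (rule has_field_derivative_transform_within_open[OF gauss_kernel_primitive_deriv[OF that], of "{0<..}"])
       (use that in \<open>auto simp: F_def\<close>)
  have F0: "(F \<longlongrightarrow> 0) (at_right 0)"
    using gauss_kernel_primitive_at_0[OF y]
    by (rule Lim_transform_eventually) (auto simp: F_def eventually_at_right_less intro!: eventually_at_rightI[of 0 1])
  have cont: "continuous_on {0..} F"
    unfolding continuous_on_def
  proof
    fix s :: real assume "s \<in> {0..}"
    then consider "s = 0" | "0 < s" by fastforce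
    then show "(F \<longlongrightarrow> F s) (at s within {0..})"
    proof cases
      case 1 
      then show ?thesis using F0 by (simp add: F_def at_within_Ici_at_right)
    next
      case 2
      then have "isCont F s" by (intro DERIV_isCont[OF d])
      then have "continuous (at s within {0..}) F" by (rule continuous_at_imp_continuous_at_within)
      then show ?thesis by (simp add: continuous_within)
    qed
  qed
  have lim: "(F \<longlongrightarrow> 1) at_top"
    using gauss_kernel_primitive_at_top[of y]
    by (rule Lim_transform_eventually)
       (auto simp: F_def intro!: eventually_mono[OF eventually_gt_at_top[of 0]])
  have F_0: "F 0 = 0" by (simp add: F_def)
  have mono: "gauss_kernel y s \<le> gauss_kernel y t" if "0 \<le> s" "s \<le> t" "t \<le> ?p" for s t
    using that by (rule gauss_kernel_mono)
  have anti: "gauss_kernel y t \<le> gauss_kernel y s" if "?p \<le> s" "s \<le> t" for s t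
    using that p by (intro gauss_kernel_antimono) auto
  note * = unimodal_riemann_sum[OF \<eta> less_imp_le[OF p] cont d F_0 lim
      gauss_kernel_nonneg gauss_kernel_0 mono anti]
  show "summable (\<lambda>n. gauss_kernel y (\<eta> * real n))"
    by (rule *(1))
  have "\<bar>\<eta> * (\<Sum>n. gauss_kernel y (\<eta> * real n)) - 1\<bar> \<le> 2 * \<eta> * gauss_kernel y ?p"
    by (rule *(2))
  \<comment> \<open>The Gaussian exponent is nonpositive, so the exponential is at most 1.\<close>
  also have "gauss_kernel y ?p \<le> 1 / sqrt (4 * pi * ?p)"
    unfolding gauss_kernel_def using p by (intro divide_right_mono) auto
  finally show "\<bar>\<eta> * (\<Sum>n. gauss_kernel y (\<eta> * real n)) - 1\<bar> \<le> 2 * \<eta> / sqrt (4 * pi * ?p)"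
    using \<eta> by (simp add: mult_left_mono)
qed

text \<open>The peak moves off to infinity with \<open>y\<close>, so the Riemann sum error vanishes.
  For this explicit density the estimate takes the place of a renewal theorem.\<close>

lemma renewal_density_tendsto:
  assumes \<eta>: "0 < \<eta>"
  shows "((\<lambda>y. \<Sum>n. gauss_kernel y (\<eta> * real n)) \<longlongrightarrow> 1 / \<eta>) at_top"
proof -
  have "((\<lambda>y. 2 * \<eta> / sqrt (4 * pi * gauss_kernel_peak y)) \<longlongrightarrow> 0) at_top"
    unfolding gauss_kernel_peak_def by real_asymp
  then have "((\<lambda>y. \<eta> * (\<Sum>n. gauss_kernel y (\<eta> * real n)) - 1) \<longlongrightarrow> 0) at_top"
    by (rule Lim_null_comparison[rotated])
       (auto intro!: eventually_mono[OF eventually_gt_at_top[of 0]] gauss_kernel_sum(2)[OF \<eta>])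
  then have "((\<lambda>y. (\<eta> * (\<Sum>n. gauss_kernel y (\<eta> * real n)) - 1 + 1) / \<eta>) \<longlongrightarrow> (0 + 1) / \<eta>) at_top"
    by (intro tendsto_intros) (use \<eta> in auto)
  then show ?thesis using \<eta> by simp
qed

text \<open>For \<open>y \<ge> 1\<close> the peak stays above \<open>sqrt 2 - 1\<close>, so the
  error is bounded uniformly. This supplies the constant for dominated convergence.\<close>

lemma renewal_density_bounded:
  assumes \<eta>: "0 < \<eta>"
  obtains K where "\<And>y. 1 \<le> y \<Longrightarrow> (\<Sum>n. gauss_kernel y (\<eta> * real n)) \<le> K"
proof
  fix y :: real assume y: "1 \<le> y"
  have "sqrt (1\<^sup>2 + 1) - 1 \<le> gauss_kernel_peak y" unfolding gauss_kernel_peak_def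
    using y by (intro diff_mono real_sqrt_le_mono add_mono power_mono) auto
  moreover from this have "0 < gauss_kernel_peak y"
    by (rule less_le_trans[rotated]) auto
  ultimately have "2 * \<eta> / sqrt (4 * pi * gauss_kernel_peak y) \<le> 2 * \<eta> / sqrt (4 * pi * (sqrt 2 - 1))"
    using \<eta> by (intro divide_left_mono mult_pos_pos real_sqrt_gt_zero real_sqrt_le_mono mult_left_mono) auto
  then have "\<eta> * (\<Sum>n. gauss_kernel y (\<eta> * real n)) \<le> 1 + 2 * \<eta> / sqrt (4 * pi * (sqrt 2 - 1))"
    using gauss_kernel_sum(2)[OF \<eta>, of y] y by linarith
  then show "(\<Sum>n. gauss_kernel y (\<eta> * real n)) \<le> (1 + 2 * \<eta> / sqrt (4 * pi * (sqrt 2 - 1))) / \<eta>"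
    using \<eta> by (simp add: field_simps)
qed

section \<open>Gaussian random walks on sequence space\<close>

locale gaussian_walk =
  fixes \<eta> :: real
  assumes eta_pos: "0 < \<eta>"
begin

definition step :: "real measure" where
  "step = density lborel (normal_density (- \<eta>) (sqrt (2 * \<eta>)))"

lemma sets_step [simp, measurable_cong]: "sets step = sets borel"
  by (simp add: step_def)

lemma measurable_stepI: "f \<in> measurable borel N \<Longrightarrow> f \<in> measurable step N"
  by (simp cong: measurable_cong_sets)

lemma space_step [simp]: "space step = UNIV"
  by (simp add: step_def)

end

sublocale gaussian_walk \<subseteq> step: prob_space step
  unfolding step_def by (rule prob_space_normal_density) (use eta_pos in simp)

sublocale gaussian_walk \<subseteq> sequence_space step
  by unfold_locales

context gaussian_walk
begin

abbreviation paths :: "(nat \<Rightarrow> real) measure" where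
  "paths \<equiv> \<Pi>\<^sub>M i\<in>UNIV. step"

section \<open>Path space, the walk and its restarts\<close>

definition walk :: "nat \<Rightarrow> (nat \<Rightarrow> real) \<Rightarrow> real" where
  "walk n \<omega> = (\<Sum>i<n. \<omega> i)"

lemma measurable_coord [measurable]: "(\<lambda>\<omega>. \<omega> i) \<in> borel_measurable paths"
  using measurable_component_singleton[of i UNIV "\<lambda>_. step"]
  by (simp cong: measurable_cong_sets)

lemma measurable_walk [measurable]: "walk n \<in> borel_measurable paths"
  unfolding walk_def[abs_def] by measurable

lemma space_paths [simp]: "space paths = UNIV"
  by (simp add: space_PiM PiE_UNIV_domain)

lemma emeasure_paths_UNIV [simp]: "emeasure paths UNIV = 1"
  using P.emeasure_space_1 by simp

lemma Collect_in_sets_paths: "Measurable.pred paths A \<Longrightarrow> {\<omega>. A \<omega>} \<in> sets paths"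
  by (simp add: pred_def)

lemma walk_0 [simp]: "walk 0 \<omega> = 0"
  by (simp add: walk_def)

lemma walk_case_nat: "walk (Suc n) (case_nat s \<omega>) = s + walk n \<omega>"
  unfolding walk_def by (subst sum.lessThan_Suc_shift) simp

lemma walk_comb_seq_le: "j \<le> m \<Longrightarrow> walk j (comb_seq m \<omega> \<omega>') = walk j \<omega>"
  by (simp add: walk_def comb_seq_def)

lemma walk_comb_seq_add: "walk (m + j) (comb_seq m \<omega> \<omega>') = walk m \<omega> + walk j \<omega>'"
proof (induction j)
  case 0
  show ?case by (simp add: walk_comb_seq_le)
next
  case (Suc j)
  then show ?case by (simp add: walk_def comb_seq_def)
qed

text \<open>Conditioning on the first step: the remaining steps form a fresh path with the same
  law.\<close>

lemma nn_integral_paths_iter: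
  assumes [measurable]: "f \<in> borel_measurable paths"
  shows "(\<integral>\<^sup>+\<omega>. f \<omega> \<partial>paths) = (\<integral>\<^sup>+s. (\<integral>\<^sup>+\<omega>. f (case_nat s \<omega>) \<partial>paths) \<partial>step)"
proof -
  have "(\<integral>\<^sup>+\<omega>. f \<omega> \<partial>paths) = (\<integral>\<^sup>+\<omega>. f \<omega> \<partial>distr (step \<Otimes>\<^sub>M paths) paths (\<lambda>(s, \<omega>). case_nat s \<omega>))"
    by (simp only: PiM_iter)
  also have "\<dots> = (\<integral>\<^sup>+z. f (case_nat (fst z) (snd z)) \<partial>(step \<Otimes>\<^sub>M paths))"
    by (subst nn_integral_distr) (auto simp: split_beta')
  also have "\<dots> = (\<integral>\<^sup>+s. (\<integral>\<^sup>+\<omega>. f (case_nat s \<omega>) \<partial>paths) \<partial>step)"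
    by (subst P.nn_integral_fst[symmetric]) auto
  finally show ?thesis .
qed

text \<open>The Markov property at the fixed time \<open>m\<close>: the first \<open>m\<close> steps
  are taken from \<open>\<omega>\<close>, all later ones from an independent copy
  \<open>\<omega>'\<close>.\<close>

lemma nn_integral_paths_comb:
  assumes [measurable]: "f \<in> borel_measurable paths"
  shows "(\<integral>\<^sup>+\<omega>. f \<omega> \<partial>paths) = (\<integral>\<^sup>+\<omega>. (\<integral>\<^sup>+\<omega>'. f (comb_seq m \<omega> \<omega>') \<partial>paths) \<partial>paths)"
proof -
  have "(\<integral>\<^sup>+\<omega>. f \<omega> \<partial>paths) = (\<integral>\<^sup>+\<omega>. f \<omega> \<partial>distr (paths \<Otimes>\<^sub>M paths) paths (\<lambda>(\<omega>, \<omega>'). comb_seq m \<omega> \<omega>'))"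
    by (simp only: PiM_comb_seq)
  also have "\<dots> = (\<integral>\<^sup>+z. f (comb_seq m (fst z) (snd z)) \<partial>(paths \<Otimes>\<^sub>M paths))"
    by (subst nn_integral_distr) (auto simp: split_beta')
  also have "\<dots> = (\<integral>\<^sup>+\<omega>. (\<integral>\<^sup>+\<omega>'. f (comb_seq m \<omega> \<omega>') \<partial>paths) \<partial>paths)"
    by (subst P.nn_integral_fst[symmetric]) auto
  finally show ?thesis .
qed

lemma nn_integral_step:
  assumes [measurable]: "f \<in> borel_measurable borel"
  shows "(\<integral>\<^sup>+s. f s \<partial>step) = (\<integral>\<^sup>+s. ennreal (normal_density (- \<eta>) (sqrt (2 * \<eta>)) s) * f s \<partial>lborel)"
  unfolding step_def by (subst nn_integral_density) auto

text \<open>Completing the square. Tilting by \<open>\<theta>\<close> moves the mean by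
  \<open>2 * \<eta> * \<theta>\<close> and keeps the variance; \<open>\<theta> = 1\<close> reverses
  the drift with prefactor 1.\<close>

lemma exp_times_normal_density:
  "exp (\<theta> * s) * normal_density (- \<eta>) (sqrt (2 * \<eta>)) s =
   exp (\<eta> * \<theta>\<^sup>2 - \<eta> * \<theta>) * normal_density (2 * \<eta> * \<theta> - \<eta>) (sqrt (2 * \<eta>)) s"
proof -
  have "\<theta> * s + - (s - - \<eta>)\<^sup>2 / (2 * (sqrt (2 * \<eta>))\<^sup>2) =
     (\<eta> * \<theta>\<^sup>2 - \<eta> * \<theta>) + - (s - (2 * \<eta> * \<theta> - \<eta>))\<^sup>2 / (2 * (sqrt (2 * \<eta>))\<^sup>2)"
    using eta_pos by (simp add: field_simps power2_eq_square)
  then have "exp (\<theta> * s) * exp (- (s - - \<eta>)\<^sup>2 / (2 * (sqrt (2 * \<eta>))\<^sup>2)) =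
     exp (\<eta> * \<theta>\<^sup>2 - \<eta> * \<theta>) * exp (- (s - (2 * \<eta> * \<theta> - \<eta>))\<^sup>2 / (2 * (sqrt (2 * \<eta>))\<^sup>2))"
    by (simp only: mult_exp_exp)
  then show ?thesis unfolding normal_density_def by (simp add: field_simps)
qed

lemma exp_moment_step: "(\<integral>\<^sup>+s. ennreal (exp (\<theta> * s)) \<partial>step) = ennreal (exp (\<eta> * \<theta>\<^sup>2 - \<eta> * \<theta>))"
proof -
  have "(\<integral>\<^sup>+s. ennreal (exp (\<theta> * s)) \<partial>step) =
    (\<integral>\<^sup>+s. ennreal (exp (\<eta> * \<theta>\<^sup>2 - \<eta> * \<theta>) * normal_density (2 * \<eta> * \<theta> - \<eta>) (sqrt (2 * \<eta>)) s) \<partial>lborel)"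
    unfolding exp_times_normal_density[symmetric]
    by (subst nn_integral_step) (auto intro!: nn_integral_cong simp: ennreal_mult'[symmetric] mult.commute)
  also have "\<dots> = ennreal (exp (\<eta> * \<theta>\<^sup>2 - \<eta> * \<theta>))"
    using eta_pos by (subst nn_integral_eq_integral) auto
  finally show ?thesis .
qed

lemma exp_moment_walk:
  "(\<integral>\<^sup>+\<omega>. ennreal (exp (\<theta> * walk n \<omega>)) \<partial>paths) = ennreal (exp (\<eta> * \<theta>\<^sup>2 - \<eta> * \<theta>) ^ n)"
proof (induction n)
  case 0
  show ?case by simp
next
  case (Suc n)
  have "(\<integral>\<^sup>+\<omega>. ennreal (exp (\<theta> * walk (Suc n) \<omega>)) \<partial>paths) =
    (\<integral>\<^sup>+s. (\<integral>\<^sup>+\<omega>. ennreal (exp (\<theta> * s)) * ennreal (exp (\<theta> * walk n \<omega>)) \<partial>paths) \<partial>step)"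
    by (subst nn_integral_paths_iter)
       (auto simp: walk_case_nat distrib_left exp_add ennreal_mult)
  also have "\<dots> = (\<integral>\<^sup>+s. ennreal (exp (\<theta> * s)) * ennreal (exp (\<eta> * \<theta>\<^sup>2 - \<eta> * \<theta>) ^ n) \<partial>step)"
    by (simp add: nn_integral_cmult Suc)
  also have "\<dots> = ennreal (exp (\<eta> * \<theta>\<^sup>2 - \<eta> * \<theta>) ^ Suc n)"
    by (subst nn_integral_multc) (auto simp: exp_moment_step ennreal_mult intro!: measurable_stepI)
  finally show ?case .
qed

text \<open>The exponential moment of a step at \<open>\<theta> = 1 / 2\<close>, where it is
  smallest. Being below 1, it yields geometric decay in time.\<close>

definition rho :: real where "rho = exp (- \<eta> / 4)"

lemma rho: "0 < rho" "rho < 1"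
  using eta_pos by (auto simp: rho_def)

text \<open>The Chernoff bound with exponent \<open>1 / 2\<close>.\<close>

lemma emeasure_walk_gt:
  "emeasure paths {\<omega>. y < walk n \<omega>} \<le> ennreal (exp (- y / 2) * rho ^ n)"
proof -
  have "emeasure paths {\<omega>. y < walk n \<omega>} = (\<integral>\<^sup>+\<omega>. indicator {\<omega>. y < walk n \<omega>} \<omega> \<partial>paths)"
    by (subst nn_integral_indicator) (auto intro!: Collect_in_sets_paths)
  also have "\<dots> \<le> (\<integral>\<^sup>+\<omega>. ennreal (exp (- y / 2)) * ennreal (exp ((1/2) * walk n \<omega>)) \<partial>paths)"
    by (intro nn_integral_mono) (auto simp: indicator_def ennreal_mult'[symmetric] mult_exp_exp)
  also have "\<dots> = ennreal (exp (- y / 2) * rho ^ n)"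
    using exp_moment_walk[of "1 / 2" n]
    by (subst nn_integral_cmult) (auto simp: ennreal_mult rho_def power2_eq_square)
  finally show ?thesis .
qed

text \<open>Borel-Cantelli: the Chernoff bounds are summable in time.\<close>

lemma AE_finite_exceedances: "AE \<omega> in paths. finite {j. y < walk j \<omega>}"
proof -
  have "summable (\<lambda>n. P.prob {\<omega>. y < walk n \<omega>})"
  proof (rule summable_comparison_test')
    show "summable (\<lambda>n. exp (- y / 2) * rho ^ n)"
      using rho by (intro summable_mult summable_geometric) auto
    show "norm (P.prob {\<omega>. y < walk n \<omega>}) \<le> exp (- y / 2) * rho ^ n" if "0 \<le> n" for n
      using emeasure_walk_gt[of y n] rho by (simp add: P.emeasure_eq_measure)
  qed
  then have "AE \<omega> in paths. eventually (\<lambda>n. \<omega> \<in> space paths - {\<omega>. y < walk n \<omega>}) sequentially"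
    by (intro borel_cantelli_AE1) (auto simp: P.emeasure_eq_measure intro!: Collect_in_sets_paths)
  then show ?thesis
  proof eventually_elim
    case (elim \<omega>)
    then obtain N where "\<And>n. n \<ge> N \<Longrightarrow> \<not> y < walk n \<omega>" by (auto simp: eventually_sequentially)
    then have "{j. y < walk j \<omega>} \<subseteq> {..<N}" by (force simp: not_le[symmetric])
    then show ?case by (rule finite_subset) simp
  qed
qed

section \<open>The law of the walk at a fixed time\<close>

lemma distr_coord: "distr paths borel (\<lambda>\<omega>. \<omega> i) = step"
proof -
  have "distr paths borel (\<lambda>\<omega>. \<omega> i) = distr paths step (\<lambda>\<omega>. \<omega> i)"
    by (rule distr_cong) auto
  also have "\<dots> = step" by (rule PiM_component) simp
  finally show ?thesis .
qed

lemma indep_coords: "P.indep_vars (\<lambda>_. borel) (\<lambda>i \<omega>. \<omega> i) UNIV"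
proof (subst P.indep_vars_iff_distr_eq_PiM)
  have "distr paths (\<Pi>\<^sub>M i\<in>UNIV. borel) (\<lambda>x. restrict (\<lambda>i. x i) UNIV) = distr paths paths (\<lambda>x. x)"
    by (rule distr_cong) (auto intro!: sets_PiM_cong)
  then show "distr paths (\<Pi>\<^sub>M i\<in>UNIV. borel) (\<lambda>x. restrict (\<lambda>i. x i) UNIV) =
     (\<Pi>\<^sub>M i\<in>UNIV. distr paths borel (\<lambda>\<omega>. \<omega> i))"
    by (simp add: distr_coord distr_id2)
qed auto

lemma distributed_walk:
  assumes "0 < n"
  shows "distributed paths lborel (walk n) (normal_density (- \<eta> * n) (sqrt (2 * \<eta> * n)))"
proof -
  have "distributed paths lborel (\<lambda>\<omega>. \<Sum>i\<in>{..<n}. \<omega> i)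
     (normal_density (\<Sum>i\<in>{..<n}. - \<eta>) (sqrt (\<Sum>i\<in>{..<n}. (sqrt (2 * \<eta>))\<^sup>2)))"
  proof (rule P.sum_indep_normal)
    show "P.indep_vars (\<lambda>i. borel) (\<lambda>i \<omega>. \<omega> i) {..<n}"
      by (rule P.indep_vars_subset[OF indep_coords]) simp
    show "distributed paths lborel (\<lambda>\<omega>. \<omega> i) (\<lambda>x. ennreal (normal_density (- \<eta>) (sqrt (2 * \<eta>)) x))" for i
    proof -
      have "distr paths lborel (\<lambda>\<omega>. \<omega> i) = distr paths borel (\<lambda>\<omega>. \<omega> i)" by (rule distr_cong) auto
      then show ?thesis unfolding distributed_def using distr_coord[of i] by (auto simp: step_def)
    qed
  qed (use assms eta_pos in auto)
  then show ?thesis using eta_pos by (simp add: walk_def[abs_def] mult_ac)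
qed

end

section \<open>Decomposition at the last exceedances\<close>

text \<open>A time \<open>m\<close> contributes iff it is the \<open>(k + 1)\<close>-st element of
  \<open>A\<close> counted from the top. There is exactly one such element when \<open>A\<close> is
  finite with more than \<open>k\<close> elements, and none otherwise.\<close>

lemma last_exit_indicator:
  fixes A :: "nat set"
  shows "(\<Sum>m. if m \<in> A \<and> finite (A \<inter> {m<..}) \<and> card (A \<inter> {m<..}) = k then 1 else 0 :: ennreal) =
    (if finite A \<and> k < card A then 1 else 0)"
proof (cases "finite A \<and> k < card A")
  case True
  then have fin: "finite A" and k: "k < card A" by auto
  \<comment> \<open>The last index from which more than \<open>k\<close> elements are still to come.
    Moving one index further loses one of them, so this index belongs to \<open>A\<close> and
    exactly \<open>k\<close> elements follow it.\<close>
  define m where "m = Max {i. k < card (A \<inter> {i..})}"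
  have le: "i \<le> Max A" if "k < card (A \<inter> {i..})" for i
  proof -
    have "A \<inter> {i..} \<noteq> {}" using that by auto
    then show ?thesis using fin by (metis Int_iff Max_ge all_not_in_conv atLeast_iff le_trans)
  qed
  have "finite {i. k < card (A \<inter> {i..})}"
    by (rule finite_subset[of _ "{..Max A}"]) (use le in auto)
  moreover have "0 \<in> {i. k < card (A \<inter> {i..})}" using k by simp
  ultimately have "m \<in> {i. k < card (A \<inter> {i..})}"
    unfolding m_def by (intro Max_in) blast+
  then have m1: "k < card (A \<inter> {m..})" by simp
  have max: "i \<le> m" if "k < card (A \<inter> {i..})" for i
    unfolding m_def using that \<open>finite {i. k < card (A \<inter> {i..})}\<close> by (intro Max_ge) auto
  have m2: "card (A \<inter> {m<..}) \<le> k"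
  proof (rule ccontr)
    assume "\<not> card (A \<inter> {m<..}) \<le> k"
    then have "k < card (A \<inter> {Suc m..})" by (simp add: atLeast_Suc_greaterThan)
    then show False using max[of "Suc m"] by simp
  qed
  have split: "A \<inter> {m..} = (if m \<in> A then insert m (A \<inter> {m<..}) else A \<inter> {m<..})"
    by (auto simp: less_le)
  have mA: "m \<in> A" and mk: "card (A \<inter> {m<..}) = k"
    using m1 m2 fin by (auto simp: split split: if_splits)
  have uniq: "n = m" if "n \<in> A" "card (A \<inter> {n<..}) = k" for n
  proof (rule ccontr)
    \<comment> \<open>The number of later elements drops strictly from each element of
      \<open>A\<close> to the next, so only one of them can have exactly \<open>k\<close>
      successors.\<close>
    have aux: "card (A \<inter> {b<..}) < card (A \<inter> {a<..})" if "a < b" "b \<in> A" for a b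
      using fin that by (intro psubset_card_mono) auto
    assume "n \<noteq> m"
    then consider "n < m" | "m < n" by linarith
    then show False using aux[of n m] aux[of m n] that mA mk by cases auto
  qed
  have "(\<lambda>n. if n \<in> A \<and> finite (A \<inter> {n<..}) \<and> card (A \<inter> {n<..}) = k then 1 else 0 :: ennreal) =
      (\<lambda>n. if n = m then 1 else 0)"
  proof
    fix n
    show "(if n \<in> A \<and> finite (A \<inter> {n<..}) \<and> card (A \<inter> {n<..}) = k then 1 else 0 :: ennreal) =
        (if n = m then 1 else 0)"
      using uniq[of n] mA mk fin by (cases "n = m") auto
  qed
  moreover have "(\<Sum>n. if n = m then 1 else 0 :: ennreal) = 1"
    by (subst suminf_finite[of "{m}"]) auto
  ultimately show ?thesis using True by simp
next
  case False
  have "\<not> (m \<in> A \<and> finite (A \<inter> {m<..}) \<and> card (A \<inter> {m<..}) = k)" for m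
  proof
    assume m: "m \<in> A \<and> finite (A \<inter> {m<..}) \<and> card (A \<inter> {m<..}) = k"
    \<comment> \<open>A finite remainder after \<open>m\<close> makes all of \<open>A\<close>
      finite, so infinite sets contribute nothing.\<close>
    have "A \<subseteq> {..m} \<union> (A \<inter> {m<..})" by auto
    then have fin: "finite A" using m by (meson finite_Un finite_atMost finite_subset)
    have "card (insert m (A \<inter> {m<..})) \<le> card A" using m fin by (intro card_mono) auto
    then show False using m False fin by simp
  qed
  then have "(\<lambda>m. if m \<in> A \<and> finite (A \<inter> {m<..}) \<and> card (A \<inter> {m<..}) = k then 1 else 0 :: ennreal) = (\<lambda>m. 0)"
    by (simp add: fun_eq_iff)
  then show ?thesis using False by (simp only: suminf_zero if_False)
qed

lemma measurable_gauss_kernel [measurable (raw)]: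
  assumes [measurable]: "f \<in> borel_measurable N" "g \<in> borel_measurable N"
  shows "(\<lambda>z. gauss_kernel (f z) (g z)) \<in> borel_measurable N"
  unfolding gauss_kernel_def by measurable

text \<open>Finite sets of naturals are enumerated by lists, of which there are countably many, so
  the event is a countable union of countable intersections of coordinate events.\<close>

lemma measurable_exceedance_set:
  fixes X :: "nat \<Rightarrow> 'b \<Rightarrow> real"
  assumes [measurable]: "f \<in> borel_measurable N" "\<And>j. X j \<in> borel_measurable N"
  shows "Measurable.pred N (\<lambda>z. finite {j \<in> L. f z < X j z} \<and> T (card {j \<in> L. f z < X j z}))"
proof -
  have eq: "(finite {j \<in> L. f z < X j z} \<and> T (card {j \<in> L. f z < X j z})) \<longleftrightarrow>
     (\<exists>xs. T (card (set xs)) \<and> (\<forall>j. (j \<in> L \<and> f z < X j z) \<longleftrightarrow> j \<in> set xs))" for z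
  proof -
    have "(\<forall>j. (j \<in> L \<and> f z < X j z) \<longleftrightarrow> j \<in> set xs) \<longleftrightarrow> {j \<in> L. f z < X j z} = set xs" for xs
      by auto
    moreover have "(finite A \<and> T (card A)) \<longleftrightarrow> (\<exists>xs. T (card (set xs)) \<and> A = set xs)" for A :: "nat set"
      using finite_list[of A] by auto
    ultimately show ?thesis by simp
  qed
  show ?thesis
    unfolding eq by measurable
qed

context gaussian_walk
begin

text \<open>Finiteness is demanded because \<open>card\<close> is 0 on infinite sets, which would
  otherwise count as zero exceedances.\<close>

definition exceeds_exactly :: "nat \<Rightarrow> nat set \<Rightarrow> real \<Rightarrow> (nat \<Rightarrow> real) \<Rightarrow> bool" where
  "exceeds_exactly k L x \<omega> \<longleftrightarrow> finite {j \<in> L. x < walk j \<omega>} \<and> card {j \<in> L. x < walk j \<omega>} = k"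

text \<open>Paths with infinitely many exceedances are left out here; by
  \<open>AE_finite_exceedances\<close> they form a null set.\<close>

definition exceeds_more :: "nat \<Rightarrow> nat set \<Rightarrow> real \<Rightarrow> (nat \<Rightarrow> real) \<Rightarrow> bool" where
  "exceeds_more k L x \<omega> \<longleftrightarrow> finite {j \<in> L. x < walk j \<omega>} \<and> k < card {j \<in> L. x < walk j \<omega>}"

lemma measurable_exceeds [measurable (raw)]:
  assumes [measurable]: "f \<in> borel_measurable N" "g \<in> measurable N paths"
  shows "Measurable.pred N (\<lambda>z. exceeds_exactly k L (f z) (g z))"
    and "Measurable.pred N (\<lambda>z. exceeds_more k L (f z) (g z))"
  unfolding exceeds_exactly_def exceeds_more_def
  using measurable_exceedance_set[of f N "\<lambda>j z. walk j (g z)" L "\<lambda>c. c = k"]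
    measurable_exceedance_set[of f N "\<lambda>j z. walk j (g z)" L "\<lambda>c. k < c"]
  by simp_all

text \<open>The level is \<open>- w\<close> since the walk restarts at height \<open>w\<close> above
  the original level.\<close>

definition exactly_prob :: "nat \<Rightarrow> nat set \<Rightarrow> real \<Rightarrow> real" where
  "exactly_prob k L w = P.prob {\<omega>. exceeds_exactly k L (- w) \<omega>}"

lemma exactly_prob_bounds: "0 \<le> exactly_prob k L w" "exactly_prob k L w \<le> 1"
  by (simp_all add: exactly_prob_def)

lemma nn_integral_if_prob:
  assumes "Measurable.pred paths A"
  shows "(\<integral>\<^sup>+\<omega>. (if A \<omega> then 1 else 0) \<partial>paths) = ennreal (P.prob {\<omega>. A \<omega>})"
proof -
  have "(\<integral>\<^sup>+\<omega>. (if A \<omega> then 1 else 0) \<partial>paths) = (\<integral>\<^sup>+\<omega>. indicator {\<omega>. A \<omega>} \<omega> \<partial>paths)"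
    by (intro nn_integral_cong) (auto simp: indicator_def)
  then show ?thesis
    using Collect_in_sets_paths[OF assms] by (simp add: P.emeasure_eq_measure)
qed

lemma measurable_exactly_prob [measurable]: "exactly_prob k L \<in> borel_measurable borel"
proof -
  have "(\<lambda>w. \<integral>\<^sup>+\<omega>. (if exceeds_exactly k L (- w) \<omega> then 1 else 0) \<partial>paths) \<in> borel_measurable borel"
    by (rule P.borel_measurable_nn_integral) measurable
  moreover have "(\<integral>\<^sup>+\<omega>. (if exceeds_exactly k L (- w) \<omega> then 1 else 0) \<partial>paths) = ennreal (exactly_prob k L w)" for w
    unfolding exactly_prob_def by (rule nn_integral_if_prob) measurable
  ultimately have "(\<lambda>w. enn2real (ennreal (exactly_prob k L w))) \<in> borel_measurable borel"
    by simp
  then show ?thesis by (simp add: exactly_prob_bounds)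
qed

text \<open>What happens after time \<open>m\<close> is a statement about the fresh path alone, with
  the level lowered by the height already reached.\<close>

lemma exceeds_exactly_comb:
  "exceeds_exactly k ((+) m ` L) x (comb_seq m \<omega> \<omega>') \<longleftrightarrow> exceeds_exactly k L (x - walk m \<omega>) \<omega>'"
proof -
  have "{j \<in> (+) m ` L. x < walk j (comb_seq m \<omega> \<omega>')} = (+) m ` {j \<in> L. x - walk m \<omega> < walk j \<omega>'}"
    by (auto simp: walk_comb_seq_add)
  then show ?thesis
    unfolding exceeds_exactly_def by (simp add: finite_image_iff card_image)
qed

text \<open>Decompose according to the \<open>(k + 1)\<close>-st exceedance counted from the end: what
  follows it is independent of the past, so only the Green function of the walk enters.\<close>

lemma nn_integral_exceeds_more:
  assumes L: "\<And>m. m \<in> H \<Longrightarrow> H \<inter> {m<..} = (+) m ` L m"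
  shows "(\<integral>\<^sup>+\<omega>. (if exceeds_more k H x \<omega> then 1 else 0) \<partial>paths) =
    (\<Sum>m. if m \<in> H then \<integral>\<^sup>+\<omega>. (if x < walk m \<omega> then ennreal (exactly_prob k (L m) (walk m \<omega> - x)) else 0) \<partial>paths else 0)"
proof -
  \<comment> \<open>The indicator that \<open>m\<close> is the exceedance followed by exactly
    \<open>k\<close> others; at most one \<open>m\<close> contributes for each path.\<close>
  define t where "t m \<omega> = (if m \<in> H \<and> x < walk m \<omega> \<and> exceeds_exactly k (H \<inter> {m<..}) x \<omega> then 1 else 0 :: ennreal)" for m \<omega>
  have [measurable]: "t m \<in> borel_measurable paths" for m
    unfolding t_def[abs_def] by measurable
  have "(if exceeds_more k H x \<omega> then 1 else 0) = (\<Sum>m. t m \<omega>)" for \<omega>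
  proof -
    have "{j \<in> H. x < walk j \<omega>} \<inter> {m<..} = {j \<in> H \<inter> {m<..}. x < walk j \<omega>}" for m by auto
    then show ?thesis
      unfolding exceeds_more_def t_def exceeds_exactly_def
      using last_exit_indicator[of "{j \<in> H. x < walk j \<omega>}" k] by simp
  qed
  then have "(\<integral>\<^sup>+\<omega>. (if exceeds_more k H x \<omega> then 1 else 0) \<partial>paths) = (\<integral>\<^sup>+\<omega>. (\<Sum>m. t m \<omega>) \<partial>paths)"
    by simp
  also have "\<dots> = (\<Sum>m. \<integral>\<^sup>+\<omega>. t m \<omega> \<partial>paths)"
    by (rule nn_integral_suminf) measurable
  also have "\<dots> = (\<Sum>m. if m \<in> H then \<integral>\<^sup>+\<omega>. (if x < walk m \<omega> then ennreal (exactly_prob k (L m) (walk m \<omega> - x)) else 0) \<partial>paths else 0)"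
  proof (intro suminf_cong)
    fix m
    show "(\<integral>\<^sup>+\<omega>. t m \<omega> \<partial>paths) = (if m \<in> H then \<integral>\<^sup>+\<omega>. (if x < walk m \<omega> then ennreal (exactly_prob k (L m) (walk m \<omega> - x)) else 0) \<partial>paths else 0)"
    proof (cases "m \<in> H")
      case True
      \<comment> \<open>The fresh path is integrated out first, with the past and hence the height
        at time \<open>m\<close> held fixed.\<close>
      have "(\<integral>\<^sup>+\<omega>'. t m (comb_seq m \<omega> \<omega>') \<partial>paths) =
          (if x < walk m \<omega> then ennreal (exactly_prob k (L m) (walk m \<omega> - x)) else 0)" for \<omega>
      proof -
        have "t m (comb_seq m \<omega> \<omega>') = (if x < walk m \<omega> then (if exceeds_exactly k (L m) (x - walk m \<omega>) \<omega>' then 1 else 0) else 0)" for \<omega>'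
          using True by (simp add: t_def L[OF True] walk_comb_seq_le exceeds_exactly_comb)
        then show ?thesis
          using nn_integral_if_prob[of "\<lambda>\<omega>'. exceeds_exactly k (L m) (x - walk m \<omega>) \<omega>'"]
          by (simp add: exactly_prob_def)
      qed
      then show ?thesis using True
        by (subst nn_integral_paths_comb[of _ m]) auto
    qed (simp add: t_def)
  qed
  finally show ?thesis .
qed

section \<open>Integral formulas for finite and infinite horizons\<close>

definition kappa :: "nat \<Rightarrow> nat set \<Rightarrow> real" where
  "kappa k L = (LINT w|lborel. indicator {0<..} w * (exp (- w) * exactly_prob k L w))"

lemma has_bochner_integral_exp_neg:
  "has_bochner_integral lborel (\<lambda>w::real. indicator {0<..} w * exp (- w)) 1"
proof -
  have "(\<integral>\<^sup>+w. ennreal (exp (- w)) * indicator {0..} w \<partial>lborel) = ennreal (0 - (- exp (- 0 :: real)))"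
  proof (rule nn_integral_FTC_atLeast)
    show "((\<lambda>w::real. - exp (- w)) \<longlongrightarrow> 0) at_top" by real_asymp
  qed (auto intro!: derivative_eq_intros)
  also have "(\<integral>\<^sup>+w. ennreal (exp (- w)) * indicator {0..} w \<partial>lborel) =
      (\<integral>\<^sup>+w. ennreal (indicator {0<..} w * exp (- w)) \<partial>lborel)"
    by (rule nn_integral_cong_AE) (auto intro!: AE_I[of _ _ "{0 :: real}"] simp: indicator_def)
  finally show ?thesis
    by (intro has_bochner_integral_nn_integral) auto
qed

lemma integrable_kappa [simp]: "integrable lborel (\<lambda>w. indicator {0<..} w * (exp (- w) * exactly_prob k L w))"
proof (rule Bochner_Integration.integrable_bound)
  show "integrable lborel (\<lambda>w::real. indicator {0<..} w * exp (- w))"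
    using has_bochner_integral_exp_neg by (rule integrable.intros)
qed (auto simp: exactly_prob_bounds indicator_def intro!: AE_I2 mult_left_le)

lemma kappa_nn: "(\<integral>\<^sup>+w. (if 0 < w then ennreal (exp (- w) * exactly_prob k L w) else 0) \<partial>lborel) = ennreal (kappa k L)"
proof -
  have "(\<integral>\<^sup>+w. (if 0 < w then ennreal (exp (- w) * exactly_prob k L w) else 0) \<partial>lborel)
     = (\<integral>\<^sup>+w. ennreal (indicator {0<..} w * (exp (- w) * exactly_prob k L w)) \<partial>lborel)"
    by (intro nn_integral_cong) (auto simp: indicator_def)
  also have "\<dots> = ennreal (kappa k L)"
    unfolding kappa_def by (rule nn_integral_eq_integral) (auto simp: exactly_prob_bounds)
  finally show ?thesis .
qed

lemma kappa_nonneg: "0 \<le> kappa k L"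
  unfolding kappa_def by (intro integral_nonneg_AE) (auto simp: exactly_prob_bounds)

text \<open>For each last-exit time \<open>m\<close> the integral over the level factors into
  \<open>exp (walk m \<omega>)\<close>, whose mean is 1, and the constant \<open>kappa\<close> for
  the remaining \<open>n - m\<close> times.\<close>

lemma finite_horizon_integral:
  "(\<integral>\<^sup>+x. ennreal (exp x) * (\<integral>\<^sup>+\<omega>. (if exceeds_more k {..n} x \<omega> then 1 else 0) \<partial>paths) \<partial>lborel) =
    ennreal (\<Sum>l\<le>n. kappa k {0<..l})"
proof -
  let ?Q = "\<lambda>m x \<omega>. if x < walk m \<omega> then ennreal (exactly_prob k {0<..n - m} (walk m \<omega> - x)) else 0"
  have shift: "{..n} \<inter> {m<..} = (+) m ` {0<..n - m}" for m
  proof (intro set_eqI iffI)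
    fix j assume "j \<in> {..n} \<inter> {m<..}"
    then show "j \<in> (+) m ` {0<..n - m}" by (intro image_eqI[of _ _ "j - m"]) auto
  qed auto
  have sum: "(\<integral>\<^sup>+\<omega>. (if exceeds_more k {..n} x \<omega> then 1 else 0) \<partial>paths) = (\<Sum>m\<le>n. \<integral>\<^sup>+\<omega>. ?Q m x \<omega> \<partial>paths)" for x
    by (subst nn_integral_exceeds_more[OF shift], subst suminf_finite[of "{..n}"]) auto
  have one: "(\<integral>\<^sup>+x. ennreal (exp x) * (\<integral>\<^sup>+\<omega>. ?Q m x \<omega> \<partial>paths) \<partial>lborel) = ennreal (kappa k {0<..n - m})" for m
  proof -
    have [measurable]: "case_prod (?Q m) \<in> borel_measurable (borel \<Otimes>\<^sub>M paths)"
      by measurable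
    have "(\<integral>\<^sup>+x. ennreal (exp x) * (\<integral>\<^sup>+\<omega>. ?Q m x \<omega> \<partial>paths) \<partial>lborel) =
       (\<integral>\<^sup>+x. (\<integral>\<^sup>+\<omega>. ennreal (exp x) * ?Q m x \<omega> \<partial>paths) \<partial>lborel)"
      by (intro nn_integral_cong nn_integral_cmult[symmetric]) measurable
    also have "\<dots> = (\<integral>\<^sup>+\<omega>. (\<integral>\<^sup>+x. ennreal (exp x) * ?Q m x \<omega> \<partial>lborel) \<partial>paths)"
    proof -
      interpret pair_sigma_finite lborel paths ..
      show ?thesis by (rule Fubini'[symmetric]) measurable
    qed
    also have "\<dots> = (\<integral>\<^sup>+\<omega>. ennreal (exp (walk m \<omega>)) * ennreal (kappa k {0<..n - m}) \<partial>paths)"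
    proof (intro nn_integral_cong)
      fix \<omega>
      have "(\<integral>\<^sup>+x. ennreal (exp x) * ?Q m x \<omega> \<partial>lborel) =
        (\<integral>\<^sup>+w. ennreal (exp (walk m \<omega>)) * (if 0 < w then ennreal (exp (- w) * exactly_prob k {0<..n - m} w) else 0) \<partial>lborel)"
        \<comment> \<open>The new variable is the overshoot
          \<open>w = walk m \<omega> - x\<close>.\<close>
        by (subst nn_integral_real_affine[where c="-1" and t="walk m \<omega>"])
           (auto intro!: nn_integral_cong simp: ennreal_mult'[symmetric] exp_diff exp_minus field_simps)
      also have "\<dots> = ennreal (exp (walk m \<omega>)) * ennreal (kappa k {0<..n - m})"
        by (subst nn_integral_cmult) (auto simp: kappa_nn)
      finally show "(\<integral>\<^sup>+x. ennreal (exp x) * ?Q m x \<omega> \<partial>lborel) = ennreal (exp (walk m \<omega>)) * ennreal (kappa k {0<..n - m})" .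
    qed
    also have "\<dots> = ennreal (kappa k {0<..n - m})"
      using exp_moment_walk[of 1 m] by (subst nn_integral_multc) auto
    finally show ?thesis .
  qed
  have meas: "(\<lambda>x. \<integral>\<^sup>+\<omega>. ?Q m x \<omega> \<partial>paths) \<in> borel_measurable borel" for m
    by (rule P.borel_measurable_nn_integral) measurable
  have "(\<integral>\<^sup>+x. ennreal (exp x) * (\<integral>\<^sup>+\<omega>. (if exceeds_more k {..n} x \<omega> then 1 else 0) \<partial>paths) \<partial>lborel) =
     (\<integral>\<^sup>+x. (\<Sum>m\<le>n. ennreal (exp x) * (\<integral>\<^sup>+\<omega>. ?Q m x \<omega> \<partial>paths)) \<partial>lborel)"
    by (simp only: sum sum_distrib_left)
  also have "\<dots> = (\<Sum>m\<le>n. \<integral>\<^sup>+x. ennreal (exp x) * (\<integral>\<^sup>+\<omega>. ?Q m x \<omega> \<partial>paths) \<partial>lborel)"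
    by (intro nn_integral_sum borel_measurable_times_ennreal measurable_compose[OF _ measurable_ennreal]) 
       (use meas in auto)
  also have "\<dots> = (\<Sum>m\<le>n. ennreal (kappa k {0<..n - m}))"
    by (simp only: one)
  \<comment> \<open>The sum is reindexed by the number \<open>l = n - m\<close> of times that
    remain.\<close>
  also have "\<dots> = (\<Sum>l\<le>n. ennreal (kappa k {0<..l}))"
    by (rule sum.reindex_bij_witness[where i="\<lambda>l. n - l" and j="\<lambda>m. n - m"]) auto
  also have "\<dots> = ennreal (\<Sum>l\<le>n. kappa k {0<..l})"
    by (intro sum_ennreal) (auto simp: kappa_nonneg)
  finally show ?thesis .
qed

text \<open>The Green density of the walk with upward drift \<open>\<eta>\<close>; the starting
  point contributes nothing since the kernel vanishes at time 0.\<close>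

definition renewal_density :: "real \<Rightarrow> real" where
  "renewal_density y = (\<Sum>n. gauss_kernel y (\<eta> * real n))"

text \<open>Completing the square: the exponential weight turns the law with mean
  \<open>- \<eta> * real m\<close> into the one with mean \<open>\<eta> * real m\<close> and the
  same variance.\<close>

lemma normal_density_tilt:
  assumes "0 < m"
  shows "exp y * normal_density (- \<eta> * real m) (sqrt (2 * \<eta> * real m)) y = gauss_kernel y (\<eta> * real m)"
proof -
  define s where "s = \<eta> * real m"
  have s: "0 < s" using assms eta_pos by (simp add: s_def)
  have "y + - (y - - s)\<^sup>2 / (2 * (sqrt (2 * s))\<^sup>2) = - (y - s)\<^sup>2 / (4 * s)"
    using s by (simp add: field_simps power2_eq_square)
  then have "exp y * exp (- (y - - s)\<^sup>2 / (2 * (sqrt (2 * s))\<^sup>2)) = exp (- (y - s)\<^sup>2 / (4 * s))"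
    by (simp only: mult_exp_exp)
  then have "exp y * normal_density (- s) (sqrt (2 * s)) y = gauss_kernel y s"
    using s unfolding normal_density_def gauss_kernel_def by (simp add: field_simps)
  then show ?thesis by (simp add: s_def mult.assoc)
qed

text \<open>Writing the height at the last-exit time as \<open>x + w\<close> splits
  \<open>exp x\<close> into \<open>exp (x + w)\<close>, which tilts the density of the walk, and the
  weight \<open>exp (- w)\<close>. Summing the tilted densities over time gives the renewal
  density.\<close>

lemma infinite_horizon_integral:
  assumes x: "0 < x"
  shows "ennreal (exp x) * (\<integral>\<^sup>+\<omega>. (if exceeds_more k UNIV x \<omega> then 1 else 0) \<partial>paths) =
    (\<integral>\<^sup>+w. (if 0 < w then ennreal (exp (- w) * exactly_prob k {0<..} w * renewal_density (x + w)) else 0) \<partial>lborel)"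
proof -
  let ?q = "exactly_prob k {0<..}"
  let ?Q = "\<lambda>m \<omega>. if x < walk m \<omega> then ennreal (?q (walk m \<omega> - x)) else 0"
  let ?R = "\<lambda>m w. if 0 < w then ennreal (exp (- w) * ?q w * gauss_kernel (x + w) (\<eta> * real m)) else 0"
  have shift: "UNIV \<inter> {m<..} = (+) m ` {0<..}" for m :: nat
  proof (intro set_eqI iffI)
    fix j assume "j \<in> UNIV \<inter> {m<..}"
    then show "j \<in> (+) m ` {0<..}" by (intro image_eqI[of _ _ "j - m"]) auto
  qed auto
  have each: "ennreal (exp x) * (\<integral>\<^sup>+\<omega>. ?Q m \<omega> \<partial>paths) = (\<integral>\<^sup>+w. ?R m w \<partial>lborel)" for m
  proof (cases "m = 0")
    case True
    \<comment> \<open>Both sides vanish: the walk starts at 0, below the positive level, and the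
      kernel is 0 at time 0.\<close>
    then show ?thesis using x by (simp cong: if_cong)
  next
    case False
    let ?d = "normal_density (- \<eta> * real m) (sqrt (2 * \<eta> * real m))"
    have "(\<integral>\<^sup>+\<omega>. ?Q m \<omega> \<partial>paths) = (\<integral>\<^sup>+t. ennreal (?d t) * (if x < t then ennreal (?q (t - x)) else 0) \<partial>lborel)"
      using distributed_walk[of m] False
      by (intro distributed_nn_integral[symmetric, where g="\<lambda>t. if x < t then ennreal (?q (t - x)) else 0"]) auto
    also have "\<dots> = (\<integral>\<^sup>+w. ennreal (?d (x + w)) * (if 0 < w then ennreal (?q w) else 0) \<partial>lborel)"
      by (subst nn_integral_real_affine[where c=1 and t=x]) (auto cong: if_cong)
    finally have "ennreal (exp x) * (\<integral>\<^sup>+\<omega>. ?Q m \<omega> \<partial>paths) =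
       (\<integral>\<^sup>+w. ennreal (exp x) * (ennreal (?d (x + w)) * (if 0 < w then ennreal (?q w) else 0)) \<partial>lborel)"
      by (simp add: nn_integral_cmult)
    also have "\<dots> = (\<integral>\<^sup>+w. ?R m w \<partial>lborel)"
    proof (intro nn_integral_cong)
      fix w
      have "exp x * (?d (x + w) * ?q w) = exp (- w) * ?q w * gauss_kernel (x + w) (\<eta> * real m)"
        using normal_density_tilt[of m "x + w", symmetric] False by (simp add: exp_add exp_minus field_simps)
      moreover have "ennreal (exp x) * (ennreal (?d (x + w)) * ennreal (?q w)) = ennreal (exp x * (?d (x + w) * ?q w))"
        by (simp add: ennreal_mult' exactly_prob_bounds)
      ultimately show "ennreal (exp x) * (ennreal (?d (x + w)) * (if 0 < w then ennreal (?q w) else 0)) = ?R m w"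
        by (cases "0 < w") (simp_all only: if_True if_False mult_zero_right)
    qed
    finally show ?thesis .
  qed
  have "ennreal (exp x) * (\<integral>\<^sup>+\<omega>. (if exceeds_more k UNIV x \<omega> then 1 else 0) \<partial>paths) =
      (\<Sum>m. ennreal (exp x) * (\<integral>\<^sup>+\<omega>. ?Q m \<omega> \<partial>paths))"
    by (subst nn_integral_exceeds_more[OF shift]) simp_all
  also have "\<dots> = (\<integral>\<^sup>+w. (\<Sum>m. ?R m w) \<partial>lborel)"
    unfolding each by (intro nn_integral_suminf[symmetric]) simp
  also have "\<dots> = (\<integral>\<^sup>+w. (if 0 < w then ennreal (exp (- w) * ?q w * renewal_density (x + w)) else 0) \<partial>lborel)"
  proof (intro nn_integral_cong)
    fix w
    show "(\<Sum>m. ?R m w) = (if 0 < w then ennreal (exp (- w) * ?q w * renewal_density (x + w)) else 0)"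
    proof (cases "0 < w")
      case True
      have s: "summable (\<lambda>m. gauss_kernel (x + w) (\<eta> * real m))"
        using gauss_kernel_sum(1)[OF eta_pos, of "x + w"] x True by simp
      have "(\<Sum>m. ennreal (exp (- w) * ?q w * gauss_kernel (x + w) (\<eta> * real m))) =
         ennreal (\<Sum>m. exp (- w) * ?q w * gauss_kernel (x + w) (\<eta> * real m))"
        using eta_pos by (intro suminf_ennreal2 summable_mult s mult_nonneg_nonneg gauss_kernel_nonneg)
            (auto simp: exactly_prob_bounds)
      then show ?thesis using True s by (simp add: renewal_density_def suminf_mult)
    qed simp
  qed
  finally show ?thesis .
qed

end

section \<open>Limits of the decompositions\<close>

lemma cesaro_mean:
  fixes a :: "nat \<Rightarrow> real"
  assumes a: "a \<longlonglongrightarrow> L"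
  shows "(\<lambda>n. (\<Sum>l\<le>n. a l) / real (Suc n)) \<longlonglongrightarrow> L"
proof (rule LIMSEQ_I)
  fix r :: real assume r: "0 < r"
  obtain N where N: "\<And>n. N \<le> n \<Longrightarrow> \<bar>a n - L\<bar> < r / 2"
    using LIMSEQ_D[OF a, of "r / 2"] r by auto
  \<comment> \<open>The first \<open>N\<close> deviations form a constant that is killed by dividing
    by \<open>n + 1\<close>; all later deviations are below \<open>r / 2\<close>.\<close>
  define C where "C = (\<Sum>l<N. \<bar>a l - L\<bar>)"
  have "(\<lambda>n. C / real (Suc n)) \<longlonglongrightarrow> 0"
    by (rule LIMSEQ_Suc[OF lim_const_over_n])
  then obtain N' where N': "\<And>n. N' \<le> n \<Longrightarrow> \<bar>C / real (Suc n)\<bar> < r / 2"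
    using LIMSEQ_D[of "\<lambda>n. C / real (Suc n)" 0 "r / 2"] r by auto
  have "norm ((\<Sum>l\<le>n. a l) / real (Suc n) - L) < r" if n: "max N N' \<le> n" for n
  proof -
    have "\<bar>(\<Sum>l\<le>n. a l) - real (Suc n) * L\<bar> = \<bar>\<Sum>l\<le>n. a l - L\<bar>"
      by (simp add: sum_subtractf)
    also have "\<dots> \<le> (\<Sum>l\<le>n. \<bar>a l - L\<bar>)" by (rule sum_abs)
    also have "\<dots> = C + (\<Sum>l=N..n. \<bar>a l - L\<bar>)"
    proof -
      have "{..n} = {..<N} \<union> {N..n}" using n by auto
      then show ?thesis unfolding C_def by (simp only:) (rule sum.union_disjoint, auto)
    qed
    also have "(\<Sum>l=N..n. \<bar>a l - L\<bar>) \<le> (\<Sum>l=N..n. r / 2)"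
      by (intro sum_mono less_imp_le[OF N]) auto
    also have "\<dots> \<le> real (Suc n) * (r / 2)"
      using r by (simp add: mult_right_mono)
    finally have "\<bar>(\<Sum>l\<le>n. a l) - real (Suc n) * L\<bar> / real (Suc n) \<le> (C + real (Suc n) * (r / 2)) / real (Suc n)"
      by (intro divide_right_mono) auto
    also have "\<dots> = C / real (Suc n) + r / 2" by (simp add: add_divide_distrib del: of_nat_Suc)
    also have "\<dots> < r" proof -
      have "C / real (Suc n) < r / 2"
        by (rule le_less_trans[OF abs_ge_self N']) (use n in simp)
      then show ?thesis by linarith
    qed
    also have "\<bar>(\<Sum>l\<le>n. a l) - real (Suc n) * L\<bar> / real (Suc n) = \<bar>((\<Sum>l\<le>n. a l) - real (Suc n) * L) / real (Suc n)\<bar>"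
      by simp
    also have "((\<Sum>l\<le>n. a l) - real (Suc n) * L) / real (Suc n) = (\<Sum>l\<le>n. a l) / real (Suc n) - L"
      by (simp add: diff_divide_distrib)
    finally show ?thesis by simp
  qed
  then show "\<exists>no. \<forall>n\<ge>no. norm ((\<Sum>l\<le>n. a l) / real (Suc n) - L) < r" by blast
qed

text \<open>A vanishing integral would make the integrand zero almost everywhere and so the open
  interval a null set.\<close>

lemma nn_integral_lborel_pos:
  fixes f :: "real \<Rightarrow> ennreal"
  assumes [measurable]: "f \<in> borel_measurable borel"
    and ab: "a < b" and pos: "\<And>x. a < x \<Longrightarrow> x < b \<Longrightarrow> 0 < f x"
  shows "0 < (\<integral>\<^sup>+x. f x \<partial>lborel)"
proof (rule ccontr)
  assume "\<not> ?thesis"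
  then have "(\<integral>\<^sup>+x. f x \<partial>lborel) = 0" by simp
  then have "AE x in lborel. f x = 0" by (subst (asm) nn_integral_0_iff_AE) auto
  then have "AE x in lborel. x \<notin> {a<..<b}"
  proof eventually_elim
    case (elim x)
    then show ?case using pos[of x] by auto
  qed
  then have "emeasure lborel {a<..<b} = 0"
    by (subst (asm) AE_iff_measurable[where N="{a<..<b}"]) auto
  then show False using ab by simp
qed

context gaussian_walk
begin

section \<open>Convergence and positivity of the constants\<close>

lemma nn_integral_step_pos:
  assumes [measurable]: "f \<in> borel_measurable borel"
    and ab: "a < b" and pos: "\<And>x. a < x \<Longrightarrow> x < b \<Longrightarrow> 0 < f x"
  shows "0 < (\<integral>\<^sup>+x. f x \<partial>step)"
  unfolding nn_integral_step[OF assms(1)]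
  using eta_pos pos
  by (intro nn_integral_lborel_pos[OF _ ab]) (auto simp: ennreal_zero_less_mult_iff normal_density_pos)

lemma exactly_prob_eq_integral:
  "exactly_prob k L w = (LINT \<omega>|paths. (if exceeds_exactly k L (- w) \<omega> then 1 else 0))"
proof -
  have "(LINT \<omega>|paths. (if exceeds_exactly k L (- w) \<omega> then 1 else 0 :: real)) =
      (LINT \<omega>|paths. indicator {\<omega>. exceeds_exactly k L (- w) \<omega>} \<omega>)"
    by (intro Bochner_Integration.integral_cong) (auto simp: indicator_def)
  then show ?thesis by (simp add: exactly_prob_def)
qed

text \<open>Almost every path has a last exceedance, and once the horizon has passed it the count no
  longer changes. Dominated convergence does the rest.\<close>

lemma exactly_prob_tendsto: "(\<lambda>l. exactly_prob k {0<..l} w) \<longlonglongrightarrow> exactly_prob k {0<..} w"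
  unfolding exactly_prob_eq_integral
proof (rule integral_dominated_convergence[where w="\<lambda>_. 1"])
  show "AE \<omega> in paths. (\<lambda>l. if exceeds_exactly k {0<..l} (- w) \<omega> then 1 else 0 :: real)
      \<longlonglongrightarrow> (if exceeds_exactly k {0<..} (- w) \<omega> then 1 else 0)"
    using AE_finite_exceedances[of "- w"]
  proof eventually_elim
    case (elim \<omega>)
    then obtain N where N: "\<And>j. - w < walk j \<omega> \<Longrightarrow> j \<le> N" by (meson finite_nat_set_iff_bounded_le mem_Collect_eq)
    have "{j \<in> {0<..l}. - w < walk j \<omega>} = {j \<in> {0<..}. - w < walk j \<omega>}" if "N \<le> l" for l
      using N that by fastforce
    then have "exceeds_exactly k {0<..l} (- w) \<omega> \<longleftrightarrow> exceeds_exactly k {0<..} (- w) \<omega>" if "N \<le> l" for l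
      using that by (simp add: exceeds_exactly_def)
    then show ?case
      by (intro tendsto_eventually) (auto simp: eventually_sequentially intro!: exI[of _ N])
  qed
qed auto

lemma kappa_tendsto: "(\<lambda>l. kappa k {0<..l}) \<longlonglongrightarrow> kappa k {0<..}"
  unfolding kappa_def
proof (rule integral_dominated_convergence[where w="\<lambda>w. indicator {0<..} w * exp (- w)"])
  show "integrable lborel (\<lambda>w::real. indicator {0<..} w * exp (- w))"
    using has_bochner_integral_exp_neg by (rule integrable.intros)
  show "AE w in lborel. (\<lambda>l. indicator {0<..} w * (exp (- w) * exactly_prob k {0<..l} w))
      \<longlonglongrightarrow> indicator {0<..} w * (exp (- w) * exactly_prob k {0<..} w)"
    by (intro AE_I2 tendsto_mult tendsto_const exactly_prob_tendsto)
qed (auto simp: exactly_prob_bounds indicator_def intro!: mult_left_le)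

text \<open>Almost every path is bounded above by some natural number, so not all of these countably
  many events can be null.\<close>

lemma ex_walk_bounded_pos:
  obtains A where "0 < emeasure paths {\<omega>. \<forall>j. walk j \<omega> \<le> A}"
proof (rule ccontr)
  assume "\<not> thesis"
  then have "emeasure paths {\<omega>. \<forall>j. walk j \<omega> \<le> real A} = 0" for A :: nat
    using that[of "real A"] zero_less_iff_neq_zero by blast
  moreover have m: "{\<omega>. \<forall>j. walk j \<omega> \<le> real A} \<in> sets paths" for A :: nat
    by (rule Collect_in_sets_paths) measurable
  ultimately have "AE \<omega> in paths. \<not> (\<forall>j. walk j \<omega> \<le> real A)" for A :: nat
    by (intro AE_I[OF _ _ m]) auto
  then have "AE \<omega> in paths. \<forall>A::nat. \<not> (\<forall>j. walk j \<omega> \<le> real A)"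
    by (simp add: AE_all_countable)
  then have "AE \<omega> in paths. False"
    using AE_finite_exceedances[of 0]
  proof eventually_elim
    case (elim \<omega>)
    \<comment> \<open>Only finitely many values are positive, so their maximum exists; inserting 0
      covers paths that never become positive.\<close>
    define A where "A = nat \<lceil>Max (insert 0 ((\<lambda>j. walk j \<omega>) ` {j. 0 < walk j \<omega>}))\<rceil>"
    have "walk j \<omega> \<le> real A" for j
    proof -
      have "walk j \<omega> \<le> Max (insert 0 ((\<lambda>j. walk j \<omega>) ` {j. 0 < walk j \<omega>}))"
        by (cases "0 < walk j \<omega>") (use elim(2) in \<open>auto intro!: Max_ge simp: Max_ge_iff\<close>)
      then show ?thesis unfolding A_def using real_nat_ceiling_ge order_trans by blast
    qed
    then show ?case using elim(1) by blast
  qed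
  then show False by simp
qed

lemma exceedances_case_nat:
  "{j \<in> {0<..}. x < walk j (case_nat s \<omega>)} = Suc ` {j. x - s < walk j \<omega>}"
proof (intro set_eqI iffI)
  fix j assume "j \<in> {j \<in> {0<..}. x < walk j (case_nat s \<omega>)}"
  then show "j \<in> Suc ` {j. x - s < walk j \<omega>}"
    by (cases j) (auto simp: walk_case_nat)
qed (auto simp: walk_case_nat)

lemma exceeds_exactly_case_nat:
  "exceeds_exactly k {0<..} x (case_nat s \<omega>) \<longleftrightarrow> exceeds_exactly k UNIV (x - s) \<omega>"
  unfolding exceeds_exactly_def exceedances_case_nat by (simp add: finite_image_iff card_image)

text \<open>A negative level is exceeded at time 0, which accounts for one extra exceedance.\<close>

lemma exceeds_exactly_Suc_UNIV:
  assumes "x < 0"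
  shows "exceeds_exactly (Suc k) UNIV x \<omega> \<longleftrightarrow> exceeds_exactly k {0<..} x \<omega>"
proof -
  have "{j \<in> UNIV. x < walk j \<omega>} = insert 0 {j \<in> {0<..}. x < walk j \<omega>}"
    using assms by (auto intro: neq0_conv[THEN iffD1])
  then show ?thesis unfolding exceeds_exactly_def by auto
qed

text \<open>After the first step \<open>s\<close> the walk restarts at height \<open>w + s\<close>.
  Its own time 0 is a positive time of the original walk, hence the index set
  \<open>UNIV\<close>.\<close>

lemma exactly_prob_iter:
  "ennreal (exactly_prob k {0<..} w) =
    (\<integral>\<^sup>+s. (\<integral>\<^sup>+\<omega>. (if exceeds_exactly k UNIV (- (w + s)) \<omega> then 1 else 0) \<partial>paths) \<partial>step)"
proof -
  have "ennreal (exactly_prob k {0<..} w) = (\<integral>\<^sup>+\<omega>. (if exceeds_exactly k {0<..} (- w) \<omega> then 1 else 0) \<partial>paths)"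
    unfolding exactly_prob_def by (rule nn_integral_if_prob[symmetric]) measurable
  also have "\<dots> = (\<integral>\<^sup>+s. (\<integral>\<^sup>+\<omega>. (if exceeds_exactly k {0<..} (- w) (case_nat s \<omega>) then 1 else 0) \<partial>paths) \<partial>step)"
    by (rule nn_integral_paths_iter) measurable
  finally show ?thesis
    by (simp add: exceeds_exactly_case_nat)
qed

lemma measurable_exactly_UNIV [measurable]:
  "(\<lambda>s. \<integral>\<^sup>+\<omega>. (if exceeds_exactly k UNIV (- (w + s)) \<omega> then 1 else 0) \<partial>paths) \<in> borel_measurable borel"
  by (rule P.borel_measurable_nn_integral) measurable

text \<open>To produce exactly \<open>k\<close> exceedances, the first \<open>k\<close> steps each
  go down by less than 1, which a starting height of at least \<open>k\<close> can afford. Then one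
  large step down is followed by a path that stays bounded.\<close>

lemma exactly_prob_pos:
  assumes "real k \<le> w"
  shows "0 < exactly_prob k {0<..} w"
  using assms
proof (induction k arbitrary: w)
  case 0
  obtain A where A: "0 < emeasure paths {\<omega>. \<forall>j. walk j \<omega> \<le> A}"
    by (rule ex_walk_bounded_pos)
  have "0 < ennreal (exactly_prob 0 {0<..} w)"
    unfolding exactly_prob_iter
  \<comment> \<open>Such a step lifts the relative level above \<open>A\<close>, so a path bounded
    by \<open>A\<close> never exceeds it.\<close>
  proof (rule nn_integral_step_pos[where a="- w - A - 1" and b="- w - A"])
    fix s assume s: "s < - w - A"
    have "emeasure paths {\<omega>. \<forall>j. walk j \<omega> \<le> A} = (\<integral>\<^sup>+\<omega>. (if \<forall>j. walk j \<omega> \<le> A then 1 else 0) \<partial>paths)"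
      by (subst nn_integral_if_prob) (auto simp: P.emeasure_eq_measure)
    also have "\<dots> \<le> (\<integral>\<^sup>+\<omega>. (if exceeds_exactly 0 UNIV (- (w + s)) \<omega> then 1 else 0) \<partial>paths)"
    proof (intro nn_integral_mono)
      fix \<omega>
      have "{j \<in> UNIV. - (w + s) < walk j \<omega>} = {}" if "\<forall>j. walk j \<omega> \<le> A"
      proof -
        have "\<not> - (w + s) < walk j \<omega>" for j
          using spec[OF that, of j] s by linarith
        then show ?thesis by simp
      qed
      then show "(if \<forall>j. walk j \<omega> \<le> A then 1 else 0 :: ennreal) \<le> (if exceeds_exactly 0 UNIV (- (w + s)) \<omega> then 1 else 0)"
        unfolding exceeds_exactly_def by auto
    qed
    finally show "0 < (\<integral>\<^sup>+\<omega>. (if exceeds_exactly 0 UNIV (- (w + s)) \<omega> then 1 else 0) \<partial>paths)"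
      using A by (rule less_le_trans[rotated])
  qed auto
  then show ?case by simp
next
  case (Suc k)
  have "0 < ennreal (exactly_prob (Suc k) {0<..} w)"
    unfolding exactly_prob_iter
  \<comment> \<open>The height after the step is still positive and at least \<open>k\<close>, so
    the new position is one exceedance and the induction hypothesis supplies the other
    \<open>k\<close>.\<close>
  proof (rule nn_integral_step_pos[where a="- 1" and b=0])
    fix s :: real assume s: "- 1 < s" "s < 0"
    then have "- (w + s) < 0" using Suc.prems by simp
    then have "(\<integral>\<^sup>+\<omega>. (if exceeds_exactly (Suc k) UNIV (- (w + s)) \<omega> then 1 else 0) \<partial>paths) =
        ennreal (exactly_prob k {0<..} (w + s))"
      unfolding exactly_prob_def exceeds_exactly_Suc_UNIV[OF \<open>- (w + s) < 0\<close>]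
      by (intro nn_integral_if_prob) measurable
    then show "0 < (\<integral>\<^sup>+\<omega>. (if exceeds_exactly (Suc k) UNIV (- (w + s)) \<omega> then 1 else 0) \<partial>paths)"
      using Suc.IH[of "w + s"] Suc.prems s by simp
  qed auto
  then show ?case by simp
qed

lemma kappa_pos: "0 < kappa k {0<..}"
proof -
  have "0 < (\<integral>\<^sup>+w. (if 0 < w then ennreal (exp (- w) * exactly_prob k {0<..} w) else 0) \<partial>lborel)"
    by (rule nn_integral_lborel_pos[where a="real k" and b="real k + 1"]) (auto simp: exactly_prob_pos)
  then show ?thesis by (simp add: kappa_nn)
qed

section \<open>Asymptotics of the tail and of the integrated count\<close>

lemma renewal_density_nonneg: "0 < y \<Longrightarrow> 0 \<le> renewal_density y"
  unfolding renewal_density_def using eta_pos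
  by (intro suminf_nonneg gauss_kernel_sum(1)) (auto intro!: gauss_kernel_nonneg)

lemma measurable_renewal_density [measurable]: "renewal_density \<in> borel_measurable borel"
  unfolding renewal_density_def[abs_def] by measurable

text \<open>Dominated convergence in the integral formula: for \<open>x \<ge> 1\<close> the renewal
  density at \<open>x + w\<close> is bounded by a constant, and it tends to
  \<open>1 / \<eta>\<close> for each fixed \<open>w\<close>.\<close>

lemma exceeds_more_tail_asymptotics:
  "((\<lambda>x. exp x * P.prob {\<omega>. exceeds_more k UNIV x \<omega>}) \<longlongrightarrow> kappa k {0<..} / \<eta>) at_top"
proof -
  let ?f = "\<lambda>x w. indicator {0<..} w * (exp (- w) * exactly_prob k {0<..} w) * renewal_density (x + w)"
  let ?h = "\<lambda>w. indicator {0<..} w * (exp (- w) * exactly_prob k {0<..} w)"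
  obtain K where K: "\<And>y. 1 \<le> y \<Longrightarrow> renewal_density y \<le> K"
    using renewal_density_bounded[OF eta_pos] unfolding renewal_density_def by metis
  have nonneg: "0 \<le> ?f x w" if "0 \<le> x" for x w
    using that by (auto simp: indicator_def exactly_prob_bounds intro!: mult_nonneg_nonneg renewal_density_nonneg)
  have le: "norm (?f x w) \<le> K * ?h w" if "1 \<le> x" for x w
  proof (cases "0 < w")
    case True
    have "?f x w \<le> ?h w * K"
      using K[of "x + w"] that True by (intro mult_left_mono) (auto simp: exactly_prob_bounds)
    then show ?thesis using nonneg[of x w] that by (simp add: mult.commute)
  qed simp
  have int: "integrable lborel (?f x)" if "1 \<le> x" for x
    by (rule Bochner_Integration.integrable_bound[OF integrable_mult_right[OF integrable_kappa, of K]])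
       (use le[OF that] in \<open>auto intro!: AE_I2 order_trans[OF _ abs_ge_self]\<close>)
  have eq: "(LINT w|lborel. ?f x w) = exp x * P.prob {\<omega>. exceeds_more k UNIV x \<omega>}" if x: "1 \<le> x" for x
  proof -
    have "ennreal (exp x * P.prob {\<omega>. exceeds_more k UNIV x \<omega>}) =
       ennreal (exp x) * (\<integral>\<^sup>+\<omega>. (if exceeds_more k UNIV x \<omega> then 1 else 0) \<partial>paths)"
      by (subst nn_integral_if_prob) (auto simp: ennreal_mult')
    also have "\<dots> = (\<integral>\<^sup>+w. ennreal (?f x w) \<partial>lborel)"
      using x by (subst infinite_horizon_integral) (auto intro!: nn_integral_cong simp: indicator_def)
    also have "\<dots> = ennreal (LINT w|lborel. ?f x w)"
      using x nonneg[of x] by (intro nn_integral_eq_integral int) auto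
    finally show ?thesis
      using x nonneg[of x] by (subst (asm) ennreal_inj) (auto intro!: integral_nonneg_AE)
  qed
  have "((\<lambda>x. LINT w|lborel. ?f x w) \<longlongrightarrow> (LINT w|lborel. ?h w * (1 / \<eta>))) at_top"
  proof (rule integral_dominated_convergence_at_top[where w="\<lambda>w. K * ?h w"])
    show "AE w in lborel. ((\<lambda>x. ?f x w) \<longlongrightarrow> ?h w * (1 / \<eta>)) at_top"
    proof (intro AE_I2 tendsto_mult tendsto_const)
      fix w
      have "filterlim (\<lambda>x::real. x + w) at_top at_top" by real_asymp
      then show "((\<lambda>x. renewal_density (x + w)) \<longlongrightarrow> 1 / \<eta>) at_top"
        unfolding renewal_density_def
        by (rule filterlim_compose[OF renewal_density_tendsto[OF eta_pos]])
    qed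
    show "\<forall>\<^sub>F x in at_top. AE w in lborel. norm (?f x w) \<le> K * ?h w"
      using eventually_ge_at_top[of 1] by eventually_elim (use le in auto)
  qed auto
  also have "(LINT w|lborel. ?h w * (1 / \<eta>)) = kappa k {0<..} / \<eta>"
    by (simp add: kappa_def)
  finally show ?thesis
    by (rule Lim_transform_eventually) (use eventually_ge_at_top[of 1] in \<open>eventually_elim, simp add: eq\<close>)
qed

lemma exceeds_more_integral_eq:
  "(LINT x|lborel. exp x * P.prob {\<omega>. exceeds_more k {..n} x \<omega>}) = (\<Sum>l\<le>n. kappa k {0<..l})"
proof -
  have [measurable]: "(\<lambda>x. P.prob {\<omega>. exceeds_more k {..n} x \<omega>}) \<in> borel_measurable borel"
  proof -
    have "(\<lambda>x. \<integral>\<^sup>+\<omega>. (if exceeds_more k {..n} x \<omega> then 1 else 0) \<partial>paths) \<in> borel_measurable borel"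
      by (rule P.borel_measurable_nn_integral) measurable
    moreover have "(\<integral>\<^sup>+\<omega>. (if exceeds_more k {..n} x \<omega> then 1 else 0) \<partial>paths) = ennreal (P.prob {\<omega>. exceeds_more k {..n} x \<omega>})" for x
      by (rule nn_integral_if_prob) measurable
    ultimately have "(\<lambda>x. enn2real (ennreal (P.prob {\<omega>. exceeds_more k {..n} x \<omega>}))) \<in> borel_measurable borel"
      by simp
    then show ?thesis by simp
  qed
  have "(\<integral>\<^sup>+x. ennreal (exp x * P.prob {\<omega>. exceeds_more k {..n} x \<omega>}) \<partial>lborel) = ennreal (\<Sum>l\<le>n. kappa k {0<..l})"
    unfolding finite_horizon_integral[symmetric]
    by (intro nn_integral_cong, subst nn_integral_if_prob) (auto simp: ennreal_mult')
  then have "has_bochner_integral lborel (\<lambda>x. exp x * P.prob {\<omega>. exceeds_more k {..n} x \<omega>}) (\<Sum>l\<le>n. kappa k {0<..l})"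
    by (intro has_bochner_integral_nn_integral) (auto intro!: sum_nonneg kappa_nonneg)
  then show ?thesis by (rule has_bochner_integral_integral_eq)
qed

text \<open>The integral is a sum of convergent terms, so its average over the number of terms
  converges; that number grows like \<open>S / \<eta>\<close>.\<close>

lemma exceeds_more_integral_asymptotics:
  "((\<lambda>S. (LINT x|lborel. exp x * P.prob {\<omega>. exceeds_more k {..nat \<lfloor>S / \<eta>\<rfloor>} x \<omega>}) / S) \<longlongrightarrow> kappa k {0<..} / \<eta>) at_top"
proof -
  have 1: "filterlim (\<lambda>S. nat \<lfloor>S / \<eta>\<rfloor>) sequentially at_top"
    using eta_pos by (intro filterlim_compose[OF filterlim_nat_sequentially] filterlim_compose[OF filterlim_floor_sequentially])
      real_asymp
  \<comment> \<open>The successor counts time 0 as well.\<close>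
  have 2: "((\<lambda>S. real (Suc (nat \<lfloor>S / \<eta>\<rfloor>)) / S) \<longlongrightarrow> 1 / \<eta>) at_top"
  proof (rule tendsto_sandwich)
    show "\<forall>\<^sub>F S in at_top. 1 / \<eta> \<le> real (Suc (nat \<lfloor>S / \<eta>\<rfloor>)) / S"
      using eventually_gt_at_top[of 0]
    proof eventually_elim
      case (elim S)
      have "S / \<eta> \<le> real (Suc (nat \<lfloor>S / \<eta>\<rfloor>))" using elim eta_pos by (simp, linarith)
      then show ?case using elim eta_pos by (simp add: field_simps)
    qed
    show "\<forall>\<^sub>F S in at_top. real (Suc (nat \<lfloor>S / \<eta>\<rfloor>)) / S \<le> (S / \<eta> + 1) / S"
      using eventually_gt_at_top[of 0]
    proof eventually_elim
      case (elim S)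
      have "real (Suc (nat \<lfloor>S / \<eta>\<rfloor>)) \<le> S / \<eta> + 1" using elim eta_pos by simp
      then show ?case using elim by (intro divide_right_mono) auto
    qed
    show "((\<lambda>S. (S / \<eta> + 1) / S) \<longlongrightarrow> 1 / \<eta>) at_top"
      using eta_pos by (real_asymp simp: inverse_eq_divide)
  qed simp
  have "((\<lambda>S. (\<Sum>l\<le>nat \<lfloor>S / \<eta>\<rfloor>. kappa k {0<..l}) / real (Suc (nat \<lfloor>S / \<eta>\<rfloor>)) *
      (real (Suc (nat \<lfloor>S / \<eta>\<rfloor>)) / S)) \<longlongrightarrow> kappa k {0<..} * (1 / \<eta>)) at_top"
    by (intro tendsto_mult 2 filterlim_compose[OF cesaro_mean[OF kappa_tendsto] 1])
  then show ?thesis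
    unfolding exceeds_more_integral_eq by simp
qed

end

section \<open>Ruin of the walk\<close>

context gaussian_walk
begin

section \<open>Ruin within finitely many steps\<close>

definition ruin_by :: "nat \<Rightarrow> real \<Rightarrow> ennreal" where
  "ruin_by n x = emeasure paths {\<omega>. \<exists>j\<le>n. x < walk j \<omega>}"

lemma ruin_by_eq_nn: "ruin_by n x = (\<integral>\<^sup>+\<omega>. (if \<exists>j\<le>n. x < walk j \<omega> then 1 else 0) \<partial>paths)"
  unfolding ruin_by_def by (subst nn_integral_if_prob) (auto simp: P.emeasure_eq_measure)

lemma ruin_by_neg: "x < 0 \<Longrightarrow> ruin_by n x = 1"
proof -
  assume "x < 0"
  then have "{\<omega>. \<exists>j\<le>n. x < walk j \<omega>} = UNIV" by (auto intro!: exI[of _ 0])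
  then show ?thesis by (simp add: ruin_by_def)
qed

text \<open>At a nonnegative level time 0 is no exceedance, so ruin has to occur after the first
  step.\<close>

lemma ruin_by_Suc:
  assumes "0 \<le> x"
  shows "ruin_by (Suc n) x = (\<integral>\<^sup>+s. ruin_by n (x - s) \<partial>step)"
proof -
  have "(\<exists>j\<le>Suc n. x < walk j (case_nat s \<omega>)) \<longleftrightarrow> (\<exists>j\<le>n. x - s < walk j \<omega>)" for s \<omega>
  proof
    assume "\<exists>j\<le>Suc n. x < walk j (case_nat s \<omega>)"
    then obtain j where j: "j \<le> Suc n" "x < walk j (case_nat s \<omega>)" by blast
    with assms show "\<exists>j\<le>n. x - s < walk j \<omega>"
      by (cases j) (auto simp: walk_case_nat intro!: exI[of _ "j - 1"])
  next
    assume "\<exists>j\<le>n. x - s < walk j \<omega>"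
    then obtain j where "j \<le> n" "x - s < walk j \<omega>" by blast
    then show "\<exists>j\<le>Suc n. x < walk j (case_nat s \<omega>)"
      by (intro exI[of _ "Suc j"]) (auto simp: walk_case_nat)
  qed
  then show ?thesis
    unfolding ruin_by_eq_nn by (subst nn_integral_paths_iter) auto
qed

lemma measurable_ruin_by [measurable]: "ruin_by n \<in> borel_measurable borel"
  unfolding ruin_by_eq_nn[abs_def] by (rule P.borel_measurable_nn_integral) measurable

text \<open>The function \<open>exp (- x)\<close> dominates 1 at negative levels and is reproduced
  by the first-step recursion, because \<open>exp\<close> of a step has mean 1.\<close>

lemma ruin_by_le: "ruin_by n x \<le> ennreal (exp (- x))"
proof (induction n arbitrary: x)
  case 0
  show ?case
  proof (cases "x < 0")
    case True
    then have "ennreal 1 \<le> ennreal (exp (- x))" by (intro ennreal_leI) simp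
    then show ?thesis using True by (simp add: ruin_by_neg)
  qed (simp add: ruin_by_def)
next
  case (Suc n)
  show ?case
  proof (cases "x < 0")
    case True
    then have "ennreal 1 \<le> ennreal (exp (- x))" by (intro ennreal_leI) simp
    then show ?thesis using True by (simp add: ruin_by_neg)
  next
    case False
    then have "ruin_by (Suc n) x = (\<integral>\<^sup>+s. ruin_by n (x - s) \<partial>step)" by (intro ruin_by_Suc) simp
    also have "\<dots> \<le> (\<integral>\<^sup>+s. ennreal (exp (- x)) * ennreal (exp (1 * s)) \<partial>step)"
      by (intro nn_integral_mono order_trans[OF Suc]) (simp add: ennreal_mult'[symmetric] mult_exp_exp)
    also have "\<dots> = ennreal (exp (- x))"
      using exp_moment_step[of 1] by (subst nn_integral_cmult) (auto intro!: measurable_stepI)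
    finally show ?thesis .
  qed
qed

section \<open>Exponential overshoot and the lower bound for ruin\<close>

definition up_prob :: real where
  "up_prob = (LINT s|lborel. indicator {0<..} s * normal_density (- \<eta>) (sqrt (2 * \<eta>)) s)"

text \<open>By tilting, this is the mean of \<open>exp s\<close> over positive steps
  \<open>s\<close> of the original law.\<close>

definition tilted_up_prob :: real where
  "tilted_up_prob = (LINT s|lborel. indicator {0<..} s * normal_density \<eta> (sqrt (2 * \<eta>)) s)"

lemma normal_density_tilt_step:
  "exp s * normal_density (- \<eta>) (sqrt (2 * \<eta>)) s = normal_density \<eta> (sqrt (2 * \<eta>)) s"
  using exp_times_normal_density[of 1 s] by simp

lemma integrable_indicator_normal [simp]:
  "integrable lborel (\<lambda>s. indicator {a<..} s * normal_density \<mu> \<sigma> s)"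
  if "0 < \<sigma>" for a \<mu> \<sigma> :: real
  using integrable_mult_indicator[of "{a<..}" lborel "normal_density \<mu> \<sigma>"] that by simp

lemma up_prob_pos: "0 < up_prob"
proof -
  have "0 < (\<integral>\<^sup>+s. ennreal (indicator {0<..} s * normal_density (- \<eta>) (sqrt (2 * \<eta>)) s) \<partial>lborel)"
    using eta_pos by (intro nn_integral_lborel_pos[where a=0 and b=1]) (auto simp: normal_density_pos)
  also have "\<dots> = ennreal up_prob"
    unfolding up_prob_def using eta_pos by (intro nn_integral_eq_integral) auto
  finally show ?thesis by simp
qed

text \<open>The conditional mean of \<open>exp s\<close> for a step \<open>s\<close>, given that it
  is positive.\<close>

definition overshoot_ratio :: real where
  "overshoot_ratio = tilted_up_prob / up_prob"

lemma overshoot_ratio_ge_1: "1 \<le> overshoot_ratio"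
proof -
  have "up_prob \<le> tilted_up_prob"
    unfolding up_prob_def tilted_up_prob_def
  proof (intro integral_mono)
    fix s
    show "indicator {0<..} s * normal_density (- \<eta>) (sqrt (2 * \<eta>)) s \<le> indicator {0<..} s * normal_density \<eta> (sqrt (2 * \<eta>)) s"
      unfolding normal_density_tilt_step[symmetric]
      by (auto simp: indicator_def mult_le_cancel_right1 not_less)
  qed (use eta_pos in auto)
  then show ?thesis using up_prob_pos by (simp add: overshoot_ratio_def)
qed

text \<open>Given that a Gaussian step passes the level \<open>y\<close>, its mean exponential overshoot is largest
  for \<open>y = 0\<close>. The factor \<open>exp w - K\<close> below changes sign once, from negative to positive, and
  integrates to \<open>0\<close>, so weighting it with the decreasing function \<open>exp (- w y / (2 \<eta>))\<close> makes
  the integral nonpositive.\<close>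

lemma overshoot_le:
  assumes y: "0 \<le> y"
  shows "(LINT s|lborel. indicator {y<..} s * normal_density \<eta> (sqrt (2 * \<eta>)) s)
     \<le> exp y * overshoot_ratio * (LINT s|lborel. indicator {y<..} s * normal_density (- \<eta>) (sqrt (2 * \<eta>)) s)"
proof -
  let ?g = "normal_density (- \<eta>) (sqrt (2 * \<eta>))" and ?t = "normal_density \<eta> (sqrt (2 * \<eta>))"
  define K where "K = overshoot_ratio"
  define h where "h w = exp (- w * y / (2 * \<eta>))" for w
  \<comment> \<open>The constant in the factorisation of \<open>?g (y + w)\<close> into
    \<open>c\<close>, \<open>h w\<close> and \<open>?g w\<close>, found by setting
    \<open>w = 0\<close>.\<close>
  define c where "c = ?g y / ?g 0"
  have K1: "1 \<le> K" unfolding K_def by (rule overshoot_ratio_ge_1)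
  have g0: "0 < ?g 0" "0 < ?g y" using eta_pos by (auto intro!: normal_density_pos)
  have shift: "?g (y + w) = c * (h w * ?g w)" for w
  proof -
    have "- (y + w - - \<eta>)\<^sup>2 / (2 * (sqrt (2 * \<eta>))\<^sup>2) + - (0 - - \<eta>)\<^sup>2 / (2 * (sqrt (2 * \<eta>))\<^sup>2)
      = - (y - - \<eta>)\<^sup>2 / (2 * (sqrt (2 * \<eta>))\<^sup>2) + (- w * y / (2 * \<eta>) + - (w - - \<eta>)\<^sup>2 / (2 * (sqrt (2 * \<eta>))\<^sup>2))"
      using eta_pos by (simp add: field_simps power2_eq_square)
    then have "exp (- (y + w - - \<eta>)\<^sup>2 / (2 * (sqrt (2 * \<eta>))\<^sup>2)) * exp (- (0 - - \<eta>)\<^sup>2 / (2 * (sqrt (2 * \<eta>))\<^sup>2))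
      = exp (- (y - - \<eta>)\<^sup>2 / (2 * (sqrt (2 * \<eta>))\<^sup>2)) * (h w * exp (- (w - - \<eta>)\<^sup>2 / (2 * (sqrt (2 * \<eta>))\<^sup>2)))"
      unfolding h_def mult_exp_exp by (simp only:)
    then have "?g (y + w) * ?g 0 = ?g y * (h w * ?g w)"
      unfolding normal_density_def by (simp add: field_simps)
    then show ?thesis using g0 by (simp add: c_def field_simps)
  qed
  have h: "0 \<le> h w" "h w \<le> 1" if "0 < w" for w
    using that y eta_pos by (auto simp: h_def)
  have [measurable]: "h \<in> borel_measurable borel" unfolding h_def[abs_def] by measurable
  have bi: "integrable lborel (\<lambda>w. indicator {0<..} w * (?t w - K * ?g w))"
  proof -
    have "integrable lborel (\<lambda>w. indicator {0<..} w * ?t w - K * (indicator {0<..} w * ?g w))"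
      using eta_pos by (intro Bochner_Integration.integrable_diff integrable_mult_right) auto
    then show ?thesis by (simp add: algebra_simps)
  qed
  have bi0: "(LINT w|lborel. indicator {0<..} w * (?t w - K * ?g w)) = 0"
  proof -
    have "(LINT w|lborel. indicator {0<..} w * (?t w - K * ?g w)) =
       (LINT w|lborel. indicator {0<..} w * ?t w - K * (indicator {0<..} w * ?g w))"
      by (simp add: algebra_simps)
    also have "\<dots> = tilted_up_prob - K * up_prob"
      unfolding tilted_up_prob_def up_prob_def using eta_pos
      by (subst Bochner_Integration.integral_diff) auto
    also have "\<dots> = 0" using up_prob_pos by (simp add: K_def overshoot_ratio_def)
    finally show ?thesis .
  qed
  have hbi: "integrable lborel (\<lambda>w. indicator {0<..} w * (h w * (?t w - K * ?g w)))"
  proof (rule Bochner_Integration.integrable_bound[OF bi])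
    show "AE w in lborel. norm (indicator {0<..} w * (h w * (?t w - K * ?g w))) \<le> norm (indicator {0<..} w * (?t w - K * ?g w))"
      using h by (auto simp: indicator_def abs_mult intro!: AE_I2 mult_left_le_one_le)
  qed simp
  \<comment> \<open>The factor \<open>exp w - K\<close> changes sign at \<open>ln K\<close>.
    Replacing the decreasing weight by its value there only enlarges the integrand, on either
    side.\<close>
  have pt: "indicator {0<..} w * (h w * (?t w - K * ?g w)) \<le> h (ln K) * (indicator {0<..} w * (?t w - K * ?g w))" for w
  proof -
    have t: "?t w - K * ?g w = (exp w - K) * ?g w"
      using normal_density_tilt_step[of w] by (simp add: algebra_simps)
    have "(h w - h (ln K)) * (exp w - K) \<le> 0"
    proof (cases "w \<le> ln K")
      case True
      then have "exp w \<le> K" using K1 by (simp add: ln_ge_iff)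
      moreover have "h (ln K) \<le> h w" unfolding h_def using True y eta_pos
        by (simp add: divide_right_mono mult_right_mono)
      ultimately show ?thesis by (simp add: mult_nonneg_nonpos)
    next
      case False
      then have "K \<le> exp w" using K1 by (metis exp_ln le_less_linear less_imp_le exp_less_mono less_le_trans zero_less_one)
      moreover have "h w \<le> h (ln K)" unfolding h_def using False y eta_pos
        by (simp add: divide_right_mono mult_right_mono)
      ultimately show ?thesis by (simp add: mult_nonpos_nonneg)
    qed
    then have "(h w - h (ln K)) * (exp w - K) * ?g w \<le> 0" by (rule mult_nonpos_nonneg) simp
    then show ?thesis unfolding t by (auto simp: indicator_def algebra_simps)
  qed
  have main: "(LINT w|lborel. indicator {0<..} w * (h w * (?t w - K * ?g w))) \<le> 0"
  proof -
    have "(LINT w|lborel. indicator {0<..} w * (h w * (?t w - K * ?g w))) \<le>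
      (LINT w|lborel. h (ln K) * (indicator {0<..} w * (?t w - K * ?g w)))"
      by (rule integral_mono[OF hbi _ pt]) (intro integrable_mult_right bi)
    then show ?thesis using bi0 by simp
  qed
  have "(LINT s|lborel. indicator {y<..} s * ?t s) - exp y * K * (LINT s|lborel. indicator {y<..} s * ?g s)
    = (LINT s|lborel. indicator {y<..} s * ?t s - exp y * K * (indicator {y<..} s * ?g s))"
    using eta_pos by (subst Bochner_Integration.integral_diff) auto
  \<comment> \<open>The integration variable becomes the overshoot \<open>w = s - y\<close>.\<close>
  also have "\<dots> = (LINT w|lborel. exp y * c * (indicator {0<..} w * (h w * (?t w - K * ?g w))))"
  proof (subst lborel_integral_real_affine[where c=1 and t=y])
    have "indicator {y<..} (y + w) * ?t (y + w) - exp y * K * (indicator {y<..} (y + w) * ?g (y + w)) =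
       exp y * c * (indicator {0<..} w * (h w * (?t w - K * ?g w)))" for w
      unfolding normal_density_tilt_step[symmetric] shift
      by (auto simp: indicator_def exp_add algebra_simps)
    then show "\<bar>1\<bar> *\<^sub>R (LINT w|lborel. indicator {y<..} (y + 1 * w) * ?t (y + 1 * w) - exp y * K * (indicator {y<..} (y + 1 * w) * ?g (y + 1 * w))) =
       (LINT w|lborel. exp y * c * (indicator {0<..} w * (h w * (?t w - K * ?g w))))"
      by simp
  qed simp
  also have "\<dots> \<le> 0"
  proof -
    have "0 \<le> exp y * c" using g0 by (simp add: c_def)
    then show ?thesis
      by (subst integral_mult_right_zero) (rule mult_nonneg_nonpos[OF _ main])
  qed
  finally show ?thesis by (simp add: K_def)
qed

text \<open>Induction over the first step. A jump beyond \<open>x\<close> is ruin at once, with its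
  overshoot paid for by \<open>overshoot_ratio\<close>; otherwise the induction hypothesis applies
  at \<open>x - s\<close>. The last summand bounds what survives \<open>n\<close> steps unruined and
  shrinks by \<open>rho\<close> at every step.\<close>

lemma ruin_by_ge:
  assumes "0 \<le> x"
  shows "ennreal (exp (- x)) \<le> ennreal overshoot_ratio * ruin_by n x + ennreal (exp (- x / 2) * rho ^ n)"
  using assms
proof (induction n arbitrary: x)
  case 0
  have "ennreal (exp (- x)) \<le> ennreal (exp (- x / 2) * rho ^ 0)" using 0 by (intro ennreal_leI) simp
  then show ?case by (simp add: add_increasing)
next
  case (Suc n)
  let ?K = "ennreal overshoot_ratio"
  let ?g = "normal_density (- \<eta>) (sqrt (2 * \<eta>))" and ?t = "normal_density \<eta> (sqrt (2 * \<eta>))"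
  \<comment> \<open>The single-step estimate \<open>overshoot_le\<close> at height \<open>x\<close>;
    tilting removes the factor \<open>exp s\<close>.\<close>
  have jump: "(\<integral>\<^sup>+s. ennreal (exp (s - x)) * indicator {x<..} s \<partial>step) \<le> ?K * (\<integral>\<^sup>+s. indicator {x<..} s \<partial>step)"
  proof -
    have "(\<integral>\<^sup>+s. ennreal (exp (s - x)) * indicator {x<..} s \<partial>step) =
      (\<integral>\<^sup>+s. ennreal (exp (- x)) * ennreal (indicator {x<..} s * ?t s) \<partial>lborel)"
    proof (subst nn_integral_step)
      have "ennreal (?g s) * (ennreal (exp (s - x)) * indicator {x<..} s) = ennreal (exp (- x)) * ennreal (indicator {x<..} s * ?t s)" for s
        unfolding normal_density_tilt_step[symmetric]
        by (auto simp: indicator_def ennreal_mult'[symmetric] exp_diff exp_minus field_simps)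
      then show "(\<integral>\<^sup>+s. ennreal (?g s) * (ennreal (exp (s - x)) * indicator {x<..} s) \<partial>lborel) =
        (\<integral>\<^sup>+s. ennreal (exp (- x)) * ennreal (indicator {x<..} s * ?t s) \<partial>lborel)" by simp
    qed simp
    also have "\<dots> = ennreal (exp (- x)) * ennreal (LINT s|lborel. indicator {x<..} s * ?t s)"
      using eta_pos by (subst nn_integral_cmult) (auto intro!: arg_cong2[where f="(*)"] nn_integral_eq_integral)
    also have "\<dots> = ennreal (exp (- x) * (LINT s|lborel. indicator {x<..} s * ?t s))"
      by (simp add: ennreal_mult')
    also have "\<dots> \<le> ennreal (exp (- x) * (exp x * overshoot_ratio * (LINT s|lborel. indicator {x<..} s * ?g s)))"
      by (intro ennreal_leI mult_left_mono overshoot_le Suc.prems) simp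
    also have "\<dots> = ennreal (overshoot_ratio * (LINT s|lborel. indicator {x<..} s * ?g s))"
      by (simp add: exp_minus field_simps)
    also have "\<dots> = ?K * ennreal (LINT s|lborel. indicator {x<..} s * ?g s)"
      using overshoot_ratio_ge_1 by (simp add: ennreal_mult')
    also have "ennreal (LINT s|lborel. indicator {x<..} s * ?g s) = (\<integral>\<^sup>+s. ennreal (indicator {x<..} s * ?g s) \<partial>lborel)"
      using eta_pos by (intro nn_integral_eq_integral[symmetric]) auto
    also have "\<dots> = (\<integral>\<^sup>+s. indicator {x<..} s \<partial>step)"
      by (subst nn_integral_step) (auto intro!: nn_integral_cong simp: indicator_def)
    finally show ?thesis .
  qed
  have "ennreal (exp (- x)) = (\<integral>\<^sup>+s. ennreal (exp (s - x)) \<partial>step)"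
  proof -
    have "(\<integral>\<^sup>+s. ennreal (exp (s - x)) \<partial>step) = (\<integral>\<^sup>+s. ennreal (exp (- x)) * ennreal (exp (1 * s)) \<partial>step)"
      by (intro nn_integral_cong) (simp add: ennreal_mult'[symmetric] mult_exp_exp)
    also have "\<dots> = ennreal (exp (- x))"
      using exp_moment_step[of 1] by (subst nn_integral_cmult) (auto intro!: measurable_stepI)
    finally show ?thesis by simp
  qed
  also have "\<dots> = (\<integral>\<^sup>+s. ennreal (exp (s - x)) * indicator {x<..} s \<partial>step) + (\<integral>\<^sup>+s. ennreal (exp (s - x)) * indicator {..x} s \<partial>step)"
    by (subst nn_integral_add[symmetric]) (auto intro!: nn_integral_cong measurable_stepI simp: indicator_def)
  also have "\<dots> \<le> ?K * (\<integral>\<^sup>+s. indicator {x<..} s \<partial>step) +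
      (\<integral>\<^sup>+s. (?K * ruin_by n (x - s) + ennreal (exp (- (x - s) / 2) * rho ^ n)) * indicator {..x} s \<partial>step)"
  proof (intro add_mono jump nn_integral_mono)
    fix s
    show "ennreal (exp (s - x)) * indicator {..x} s \<le> (?K * ruin_by n (x - s) + ennreal (exp (- (x - s) / 2) * rho ^ n)) * indicator {..x} s"
      using Suc.IH[of "x - s"] by (auto simp: indicator_def)
  qed
  \<comment> \<open>Dropping the indicator from the remainder leaves the full exponential moment at
    \<open>1 / 2\<close>, which contributes one more factor \<open>rho\<close>.\<close>
  also have "\<dots> \<le> ?K * (\<integral>\<^sup>+s. indicator {x<..} s \<partial>step) +
      (\<integral>\<^sup>+s. ?K * (ruin_by n (x - s) * indicator {..x} s) + ennreal (exp (- x / 2) * rho ^ n) * ennreal (exp ((1 / 2) * s)) \<partial>step)"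
  proof (intro add_mono order_refl nn_integral_mono)
    fix s
    have "ennreal (exp (- (x - s) / 2) * rho ^ n) = ennreal (exp (- x / 2) * rho ^ n) * ennreal (exp ((1 / 2) * s))"
      using rho by (simp add: ennreal_mult'[symmetric] exp_add[symmetric] field_simps)
    then show "(?K * ruin_by n (x - s) + ennreal (exp (- (x - s) / 2) * rho ^ n)) * indicator {..x} s
       \<le> ?K * (ruin_by n (x - s) * indicator {..x} s) + ennreal (exp (- x / 2) * rho ^ n) * ennreal (exp ((1 / 2) * s))"
      by (auto simp: indicator_def)
  qed
  also have "\<dots> = ?K * ((\<integral>\<^sup>+s. indicator {x<..} s \<partial>step) + (\<integral>\<^sup>+s. ruin_by n (x - s) * indicator {..x} s \<partial>step))
      + ennreal (exp (- x / 2) * rho ^ n) * ennreal (exp (\<eta> * (1 / 2)\<^sup>2 - \<eta> * (1 / 2)))"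
  proof -
    have m1: "(\<lambda>s. ruin_by n (x - s) * indicator {..x} s) \<in> borel_measurable step"
      by (rule measurable_stepI) measurable
    have m2: "(\<lambda>s. ennreal (exp ((1 / 2) * s))) \<in> borel_measurable step"
      by (rule measurable_stepI) measurable
    have "(\<integral>\<^sup>+s. ?K * (ruin_by n (x - s) * indicator {..x} s) + ennreal (exp (- x / 2) * rho ^ n) * ennreal (exp ((1 / 2) * s)) \<partial>step)
      = ?K * (\<integral>\<^sup>+s. ruin_by n (x - s) * indicator {..x} s \<partial>step)
       + ennreal (exp (- x / 2) * rho ^ n) * ennreal (exp (\<eta> * (1 / 2)\<^sup>2 - \<eta> * (1 / 2)))"
      unfolding exp_moment_step[symmetric]
      using m1 m2 by (subst nn_integral_add) (simp_all add: nn_integral_cmult)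
    then show ?thesis by (simp add: distrib_left add.assoc)
  qed
  \<comment> \<open>For \<open>s > x\<close> the level \<open>x - s\<close> is negative and ruin has
    probability 1, so both parts merge into the first-step recursion.\<close>
  also have "(\<integral>\<^sup>+s. indicator {x<..} s \<partial>step) + (\<integral>\<^sup>+s. ruin_by n (x - s) * indicator {..x} s \<partial>step) = (\<integral>\<^sup>+s. ruin_by n (x - s) \<partial>step)"
    by (subst nn_integral_add[symmetric])
       (auto intro!: nn_integral_cong measurable_stepI simp: indicator_def ruin_by_neg)
  also have "\<dots> = ruin_by (Suc n) x" using Suc.prems by (rule ruin_by_Suc[symmetric])
  also have "ennreal (exp (- x / 2) * rho ^ n) * ennreal (exp (\<eta> * (1 / 2)\<^sup>2 - \<eta> * (1 / 2))) = ennreal (exp (- x / 2) * rho ^ Suc n)"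
    by (simp add: ennreal_mult'[symmetric] rho_def power2_eq_square mult_ac)
  finally show ?case .
qed

text \<open>The finite-horizon events increase to the infinite-horizon one, and the remainder of the
  lower bound vanishes geometrically.\<close>

lemma walk_ruin_bounds:
  assumes "0 \<le> x"
  shows "P.prob {\<omega>. \<exists>j. x < walk j \<omega>} \<le> exp (- x)"
    and "exp (- x) \<le> overshoot_ratio * P.prob {\<omega>. \<exists>j. x < walk j \<omega>}"
proof -
  let ?A = "{\<omega>. \<exists>j. x < walk j \<omega>}" and ?B = "\<lambda>n. {\<omega>. \<exists>j\<le>n. x < walk j \<omega>}"
  have ruin: "ruin_by n x = ennreal (P.prob (?B n))" for n
    by (simp add: ruin_by_def P.emeasure_eq_measure)
  have "(\<lambda>n. P.prob (?B n)) \<longlonglongrightarrow> P.prob (\<Union>n. ?B n)"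
    by (intro P.finite_Lim_measure_incseq)
       (auto simp: incseq_def intro!: Collect_in_sets_paths intro: order_trans)
  also have "(\<Union>n. ?B n) = ?A" by auto
  finally have lim: "(\<lambda>n. P.prob (?B n)) \<longlonglongrightarrow> P.prob ?A" .
  have "P.prob (?B n) \<le> exp (- x)" for n
    using ruin_by_le[of n x] by (simp add: ruin)
  then show "P.prob ?A \<le> exp (- x)"
    by (intro LIMSEQ_le_const2[OF lim]) auto
  have "exp (- x) \<le> overshoot_ratio * P.prob (?B n) + exp (- x / 2) * rho ^ n" for n
  proof -
    have "ennreal (exp (- x)) \<le> ennreal (overshoot_ratio * P.prob (?B n) + exp (- x / 2) * rho ^ n)"
      using ruin_by_ge[OF assms, of n] overshoot_ratio_ge_1 rho
      by (simp add: ruin ennreal_mult'[symmetric] ennreal_plus[symmetric] del: ennreal_plus)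
    then show ?thesis using overshoot_ratio_ge_1 rho
      by (subst (asm) ennreal_le_iff) (auto intro!: add_nonneg_nonneg mult_nonneg_nonneg)
  qed
  moreover have "(\<lambda>n. overshoot_ratio * P.prob (?B n) + exp (- x / 2) * rho ^ n) \<longlonglongrightarrow>
      overshoot_ratio * P.prob ?A + exp (- x / 2) * 0"
    by (intro tendsto_intros lim LIMSEQ_power_zero) (use rho in auto)
  ultimately show "exp (- x) \<le> overshoot_ratio * P.prob ?A"
    by (intro LIMSEQ_le_const[of _ "overshoot_ratio * P.prob ?A"]) auto
qed

end

section \<open>Overshoot of small steps\<close>

lemma normal_upper_tail:
  assumes s: "0 < \<sigma>"
  shows "(LINT t|lborel. indicator {0<..} t * normal_density \<mu> \<sigma> t) = 1 - Phi (- \<mu> / \<sigma>)"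
proof -
  interpret std: prob_space std_normal_distribution
    by (rule prob_space_normal_density) simp
  have "(LINT t|lborel. indicator {0<..} t * normal_density \<mu> \<sigma> t) =
    (LINT z|lborel. \<sigma> * (indicator {0<..} (\<mu> + \<sigma> * z) * normal_density \<mu> \<sigma> (\<mu> + \<sigma> * z)))"
    by (subst lborel_integral_real_affine[where c=\<sigma> and t=\<mu>]) (use s in auto)
  also have "\<dots> = (LINT z|lborel. indicator {- \<mu> / \<sigma><..} z * std_normal_density z)"
  proof (intro Bochner_Integration.integral_cong refl)
    fix z
    have "\<sigma> * normal_density \<mu> \<sigma> (\<mu> + \<sigma> * z) = std_normal_density z"
      using s by (simp add: normal_density_def real_sqrt_mult power_mult_distrib)
    moreover have "0 < \<mu> + \<sigma> * z \<longleftrightarrow> - \<mu> / \<sigma> < z"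
      using s by (simp add: field_simps) linarith
    ultimately show "\<sigma> * (indicator {0<..} (\<mu> + \<sigma> * z) * normal_density \<mu> \<sigma> (\<mu> + \<sigma> * z)) =
        indicator {- \<mu> / \<sigma><..} z * std_normal_density z"
      by (auto simp: indicator_def)
  qed
  also have "\<dots> = measure std_normal_distribution {- \<mu> / \<sigma><..}"
    by (simp add: measure_def emeasure_density integral_eq_nn_integral ennreal_mult'
        ennreal_indicator mult.commute)
  also have "{- \<mu> / \<sigma><..} = space std_normal_distribution - {..- \<mu> / \<sigma>}" by auto
  also have "measure std_normal_distribution \<dots> = 1 - Phi (- \<mu> / \<sigma>)"
    by (subst std.prob_compl) (auto simp: Phi_def cdf_def)
  finally show ?thesis .
qed

text \<open>In standard units the drift of a step is \<open>sqrt (e n / 2)\<close>, which vanishes;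
  numerator and denominator then share the limit \<open>1 - Phi 0\<close>.\<close>

lemma overshoot_ratio_tendsto:
  fixes e :: "nat \<Rightarrow> real"
  assumes e: "e \<longlonglongrightarrow> 0" and pos: "\<And>n. 0 < e n"
  shows "(\<lambda>n. gaussian_walk.overshoot_ratio (e n)) \<longlonglongrightarrow> 1"
proof -
  have eq: "gaussian_walk.overshoot_ratio (e n) =
      (1 - Phi (- sqrt (e n / 2))) / (1 - Phi (sqrt (e n / 2)))" for n
  proof -
    interpret gaussian_walk "e n" by unfold_locales (rule pos)
    have "e n / sqrt (2 * e n) = sqrt (e n / 2)"
      using pos[of n] by (simp add: real_sqrt_divide real_sqrt_mult field_simps)
    then show ?thesis
      unfolding overshoot_ratio_def tilted_up_prob_def up_prob_def
      using pos[of n] by (simp add: normal_upper_tail)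
  qed
  \<comment> \<open>The limiting denominator is nonzero: for the walk with parameter 1, positivity
    of \<open>up_prob\<close> reads \<open>Phi (1 / sqrt 2) < 1\<close>, and \<open>Phi\<close> is
    monotone.\<close>
  have "Phi 0 \<noteq> 1"
  proof -
    interpret gaussian_walk 1 by unfold_locales simp
    have "Phi 0 \<le> Phi (1 / sqrt 2)"
    proof -
      interpret real_distribution std_normal_distribution by (rule real_dist_normal_dist)
      show ?thesis unfolding Phi_def by (rule cdf_nondecreasing) simp
    qed
    moreover have "0 < 1 - Phi (1 / sqrt 2)"
      using up_prob_pos unfolding up_prob_def by (simp add: normal_upper_tail)
    ultimately show ?thesis by simp
  qed
  moreover have "(\<lambda>n. sqrt (e n / 2)) \<longlonglongrightarrow> sqrt (0 / 2)"
    by (intro tendsto_intros e) simp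
  ultimately have "(\<lambda>n. (1 - Phi (- sqrt (e n / 2))) / (1 - Phi (sqrt (e n / 2)))) \<longlonglongrightarrow> (1 - Phi (- 0)) / (1 - Phi 0)"
    by (intro tendsto_intros isCont_tendsto_compose[OF isCont_Phi]) (auto intro: tendsto_eq_intros)
  then show ?thesis using \<open>Phi 0 \<noteq> 1\<close> by (simp add: eq)
qed

section \<open>Brownian motion on grids\<close>

context standard_brownian_motion
begin

text \<open>Independence is a property of finite index sets, each of which lies in an initial
  segment of the grid.\<close>

lemma indep_grid_increments:
  assumes h: "0 < h"
  shows "indep_vars (\<lambda>_. borel) (\<lambda>i \<omega>. B (h * real (Suc i)) \<omega> - B (h * real i) \<omega>) UNIV"
proof -
  let ?D = "\<lambda>i \<omega>. B (h * real (Suc i)) \<omega> - B (h * real i) \<omega>"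
  have rv: "random_variable borel (?D i)" for i
    using h by (intro borel_measurable_diff random_variable_B) auto
  have fin: "indep_vars (\<lambda>_. borel) ?D {..<n}" for n
    by (rule independent_increments[of "\<lambda>i. h * real i"]) (use h in auto)
  show ?thesis
    unfolding indep_vars_def2
  proof (intro conjI ballI rv, subst indep_sets_finite_index_sets, intro allI impI)
    fix J :: "nat set" assume "finite J"
    then obtain n where "J \<subseteq> {..<n}" using finite_nat_iff_bounded by blast
    then have "indep_vars (\<lambda>_. borel) ?D J" by (rule indep_vars_subset[OF fin])
    then show "indep_sets (\<lambda>i. {?D i -` A \<inter> space M |A. A \<in> sets borel}) J"
      unfolding indep_vars_def2 by blast
  qed
qed

text \<open>The condition on \<open>a\<close> and \<open>h\<close> makes the scaled increments have
  variance \<open>2 * \<eta>\<close>. It is met by \<open>a = 2 * c\<close> with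
  \<open>\<eta> = 2 * c\<^sup>2 * h\<close>, and by \<open>a = sqrt 2\<close> with
  \<open>h = \<eta>\<close>.\<close>

lemma distr_scaled_increments:
  assumes \<eta>: "0 < \<eta>" and h: "0 < h" and a: "0 < a" "a\<^sup>2 * h = 2 * \<eta>"
  shows "distr M (\<Pi>\<^sub>M i\<in>UNIV. borel)
      (\<lambda>\<omega> i. a * (B (h * real (Suc i)) \<omega> - B (h * real i) \<omega>) - \<eta>) =
    (\<Pi>\<^sub>M i\<in>UNIV. gaussian_walk.step \<eta>)"
proof -
  interpret gw: gaussian_walk \<eta> by unfold_locales (rule \<eta>)
  let ?X = "\<lambda>i \<omega>. a * (B (h * real (Suc i)) \<omega> - B (h * real i) \<omega>) - \<eta>"
  have ind: "indep_vars (\<lambda>_. borel) ?X UNIV"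
    by (rule indep_vars_compose2[OF indep_grid_increments[OF h]]) measurable
  have rv: "random_variable borel (?X i)" for i
    using ind by (auto simp: indep_vars_def2)
  have law: "distr M borel (?X i) = gw.step" for i
  proof -
    have "distributed M lborel (\<lambda>\<omega>. B (h * real (Suc i)) \<omega> - B (h * real i) \<omega>)
        (normal_density 0 (sqrt (h * real (Suc i) - h * real i)))"
      using h by (intro normal_increments) auto
    then have "distributed M lborel (\<lambda>\<omega>. - \<eta> + a * (B (h * real (Suc i)) \<omega> - B (h * real i) \<omega>))
        (normal_density (- \<eta> + a * 0) (\<bar>a\<bar> * sqrt (h * real (Suc i) - h * real i)))"
      using h a by (intro normal_density_affine) (auto simp: algebra_simps)
    moreover have "\<bar>a\<bar> * sqrt (h * real (Suc i) - h * real i) = sqrt (a\<^sup>2 * h)"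
      by (simp add: algebra_simps real_sqrt_mult)
    ultimately have "distributed M lborel (?X i) (normal_density (- \<eta>) (sqrt (2 * \<eta>)))"
      by (simp add: a(2))
    then have "distr M lborel (?X i) = gw.step"
      unfolding gw.step_def by (rule distributed_distr_eq_density)
    moreover have "distr M lborel (?X i) = distr M borel (?X i)" by (rule distr_cong) auto
    ultimately show ?thesis by simp
  qed
  have "distr M (\<Pi>\<^sub>M i\<in>UNIV. borel) (\<lambda>\<omega>. restrict (\<lambda>i. ?X i \<omega>) UNIV) = (\<Pi>\<^sub>M i\<in>UNIV. distr M borel (?X i))"
    by (rule indep_vars_iff_distr_eq_PiM[THEN iffD1, OF _ rv ind]) simp
  then show ?thesis by (simp only: law restrict_UNIV)
qed

text \<open>Transfers any measurable property of the whole sampled sequence, so that every event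
  about Brownian motion on a grid becomes one about the walk.\<close>

lemma prob_grid_eq_prob_walk:
  assumes \<eta>: "0 < \<eta>" and h: "0 < h" and a: "0 < a" "a\<^sup>2 * h = 2 * \<eta>"
    and Q [measurable]: "Measurable.pred (\<Pi>\<^sub>M i\<in>(UNIV :: nat set). (borel :: real measure)) Q"
  shows "prob {\<omega> \<in> space M. Q (\<lambda>n. a * B (h * real n) \<omega> - \<eta> * real n)} =
    measure (\<Pi>\<^sub>M i\<in>UNIV. gaussian_walk.step \<eta>) {\<omega>. Q (\<lambda>n. gaussian_walk.walk n \<omega>)}"
proof -
  interpret gw: gaussian_walk \<eta> by unfold_locales (rule \<eta>)
  let ?X = "\<lambda>\<omega> i. a * (B (h * real (Suc i)) \<omega> - B (h * real i) \<omega>) - \<eta>"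
  have Bm [measurable]: "random_variable borel (B (h * real n))" for n
    using h by (intro random_variable_B) auto
  have B0 [measurable]: "random_variable borel (B 0)" by (intro random_variable_B) auto
  have Xm: "?X \<in> measurable M gw.paths"
  proof -
    have "?X \<in> measurable M (\<Pi>\<^sub>M i\<in>UNIV. borel)"
      using Bm[of "Suc _"] by (intro measurable_PiM_single') auto
    then show ?thesis by (simp cong: measurable_cong_sets sets_PiM_cong)
  qed
  have walk: "gw.walk n (?X \<omega>) = a * (B (h * real n) \<omega> - B 0 \<omega>) - \<eta> * real n" for n \<omega>
    by (induction n) (auto simp: gw.walk_def algebra_simps)
  have Wm: "(\<lambda>\<omega> n. gw.walk n \<omega>) \<in> measurable gw.paths (\<Pi>\<^sub>M i\<in>UNIV. borel)"
    by (intro measurable_PiM_single') auto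
  have Qp [measurable]: "Measurable.pred gw.paths (\<lambda>\<omega>. Q (\<lambda>n. gw.walk n \<omega>))"
    using Wm by measurable
  have "(\<lambda>\<omega> n. a * B (h * real n) \<omega> - \<eta> * real n) \<in> measurable M (\<Pi>\<^sub>M i\<in>UNIV. borel)"
    by (intro measurable_PiM_single') auto
  then have Qm: "Measurable.pred M (\<lambda>\<omega>. Q (\<lambda>n. a * B (h * real n) \<omega> - \<eta> * real n))"
    by measurable
  have QX: "Measurable.pred M (\<lambda>\<omega>. Q (\<lambda>n. gw.walk n (?X \<omega>)))"
    using Xm by measurable
  have "measure gw.paths {\<omega>. Q (\<lambda>n. gw.walk n \<omega>)} = measure (distr M gw.paths ?X) {\<omega>. Q (\<lambda>n. gw.walk n \<omega>)}"
  proof -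
    have "distr M gw.paths ?X = distr M (\<Pi>\<^sub>M i\<in>UNIV. borel) ?X"
      by (rule distr_cong) (auto cong: sets_PiM_cong)
    then show ?thesis using distr_scaled_increments[OF \<eta> h a] by simp
  qed
  also have "\<dots> = prob {\<omega> \<in> space M. Q (\<lambda>n. gw.walk n (?X \<omega>))}"
    using Xm by (subst measure_distr) (auto intro!: gw.Collect_in_sets_paths arg_cong[where f=prob])
  also have "\<dots> = prob {\<omega> \<in> space M. Q (\<lambda>n. a * B (h * real n) \<omega> - \<eta> * real n)}"
  \<comment> \<open>Summed increments recover \<open>B\<close> only up to \<open>B 0\<close>, which
    is 0 almost surely.\<close>
  proof (rule finite_measure_eq_AE)
    show "AE \<omega> in M. \<omega> \<in> {\<omega> \<in> space M. Q (\<lambda>n. gw.walk n (?X \<omega>))} \<longleftrightarrow>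
       \<omega> \<in> {\<omega> \<in> space M. Q (\<lambda>n. a * B (h * real n) \<omega> - \<eta> * real n)}"
      using start_zero by eventually_elim (simp only: walk, simp)
  qed (use QX Qm in \<open>auto simp: pred_def\<close>)
  finally show ?thesis by simp
qed

section \<open>The ruin probability in continuous time\<close>

lemma prob_grid_gt_bounds:
  assumes c: "0 < c" and h: "0 < h" and u: "0 \<le> u"
  shows "prob {\<omega> \<in> space M. \<exists>n. u < B (h * real n) \<omega> - c * (h * real n)} \<le> exp (- 2 * c * u)"
    and "exp (- 2 * c * u) \<le> gaussian_walk.overshoot_ratio (2 * c\<^sup>2 * h) *
      prob {\<omega> \<in> space M. \<exists>n. u < B (h * real n) \<omega> - c * (h * real n)}"
proof -
  interpret gw: gaussian_walk "2 * c\<^sup>2 * h" by unfold_locales (use c h in auto)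
  have "prob {\<omega> \<in> space M. \<exists>n. 2 * c * u < 2 * c * B (h * real n) \<omega> - 2 * c\<^sup>2 * h * real n} =
    gw.P.prob {\<omega>. \<exists>n. 2 * c * u < gw.walk n \<omega>}"
    by (rule prob_grid_eq_prob_walk[where Q="\<lambda>f. \<exists>n. 2 * c * u < f n"])
       (use c h in \<open>auto simp: power2_eq_square\<close>)
  moreover have "2 * c * u < 2 * c * b - 2 * c\<^sup>2 * h * real n \<longleftrightarrow> u < b - c * (h * real n)" for b n
  proof -
    have "2 * c * b - 2 * c\<^sup>2 * h * real n = 2 * c * (b - c * (h * real n))"
      by (simp add: algebra_simps power2_eq_square)
    then show ?thesis using c by (simp add: mult_less_cancel_left_pos)
  qed
  ultimately have eq: "prob {\<omega> \<in> space M. \<exists>n. u < B (h * real n) \<omega> - c * (h * real n)} =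
     gw.P.prob {\<omega>. \<exists>n. 2 * c * u < gw.walk n \<omega>}" by simp
  show "prob {\<omega> \<in> space M. \<exists>n. u < B (h * real n) \<omega> - c * (h * real n)} \<le> exp (- 2 * c * u)"
    and "exp (- 2 * c * u) \<le> gw.overshoot_ratio *
      prob {\<omega> \<in> space M. \<exists>n. u < B (h * real n) \<omega> - c * (h * real n)}"
    using gw.walk_ruin_bounds[of "2 * c * u"] c u unfolding eq by simp_all
qed

text \<open>By path continuity the ruin events on dyadic grids increase to the ruin event in
  continuous time. The two grid bounds close up because the overshoot ratio tends to 1 with the
  mesh.\<close>

lemma ruin_prob_eq:
  assumes c: "0 < c" and u: "0 \<le> u"
  shows "ruin_prob M B c u = exp (- 2 * c * u)"
proof -
  define h :: "nat \<Rightarrow> real" where "h m = 1 / 2 ^ m" for m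
  have h: "0 < h m" for m by (simp add: h_def)
  have h_lim: "h \<longlonglongrightarrow> 0"
    unfolding h_def[abs_def] using LIMSEQ_power_zero[of "1 / 2 :: real"] by (simp add: power_divide)
  define E where "E m = {\<omega> \<in> space M. \<exists>n. u < B (h m * real n) \<omega> - c * (h m * real n)}" for m
  have E_sets: "E m \<in> events" for m
  proof -
    have [measurable]: "random_variable borel (B (h m * real n))" for n
      using h[of m] by (intro random_variable_B) auto
    show ?thesis unfolding E_def by measurable
  qed
  have inc: "incseq E"
  proof (rule incseq_SucI)
    fix m
    \<comment> \<open>Dyadic grids are nested, so the events increase.\<close>
    have "h m * real n = h (Suc m) * real (2 * n)" for n by (simp add: h_def)
    then show "E m \<subseteq> E (Suc m)" unfolding E_def by (auto, metis)
  qed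
  have union: "{\<omega> \<in> space M. (SUP t\<in>{0..}. ereal (B t \<omega> - c * t)) > ereal u} = (\<Union>m. E m)"
  proof (intro set_eqI iffI)
    fix \<omega> assume "\<omega> \<in> (\<Union>m. E m)"
    then obtain m n where \<omega>: "\<omega> \<in> space M" "u < B (h m * real n) \<omega> - c * (h m * real n)"
      unfolding E_def by auto
    have "ereal u < ereal (B (h m * real n) \<omega> - c * (h m * real n))" using \<omega> by simp
    also have "\<dots> \<le> (SUP t\<in>{0..}. ereal (B t \<omega> - c * t))"
      using h[of m] by (intro SUP_upper) auto
    finally show "\<omega> \<in> {\<omega> \<in> space M. (SUP t\<in>{0..}. ereal (B t \<omega> - c * t)) > ereal u}"
      using \<omega> by simp
  next
    fix \<omega> assume "\<omega> \<in> {\<omega> \<in> space M. (SUP t\<in>{0..}. ereal (B t \<omega> - c * t)) > ereal u}"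
    then obtain t where \<omega>: "\<omega> \<in> space M" and t: "0 \<le> t" "u < B t \<omega> - c * t"
      by (auto simp: less_SUP_iff)
    \<comment> \<open>The last point of the \<open>m\<close>-th grid not beyond
      \<open>t\<close>.\<close>
    define s where "s m = h m * real (nat \<lfloor>t / h m\<rfloor>)" for m
    have s: "t - h m \<le> s m" "s m \<le> t" "0 \<le> s m" for m
    proof -
      have fl: "real (nat \<lfloor>t / h m\<rfloor>) = of_int \<lfloor>t / h m\<rfloor>" using t h[of m] by simp
      have "t / h m - 1 \<le> real (nat \<lfloor>t / h m\<rfloor>)" "real (nat \<lfloor>t / h m\<rfloor>) \<le> t / h m"
        unfolding fl by linarith+
      then have "h m * (t / h m - 1) \<le> s m" "s m \<le> h m * (t / h m)"
        unfolding s_def using h[of m] by (simp_all only: mult_left_mono less_imp_le)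
      then show "t - h m \<le> s m" "s m \<le> t" using h[of m] by (auto simp: algebra_simps)
      show "0 \<le> s m" using h[of m] by (simp add: s_def)
    qed
    have "s \<longlonglongrightarrow> t"
    proof (rule tendsto_sandwich)
      show "(\<lambda>m. t - h m) \<longlonglongrightarrow> t" using tendsto_diff[OF tendsto_const h_lim, of t] by simp
    qed (use s in auto)
    moreover have "continuous_on {0..} (\<lambda>t. B t \<omega> - c * t)"
      using continuous_paths[OF \<omega>] by (intro continuous_intros)
    ultimately have "(\<lambda>m. B (s m) \<omega> - c * s m) \<longlonglongrightarrow> B t \<omega> - c * t"
      using t s by (intro continuous_on_tendsto_compose[where f="\<lambda>t. B t \<omega> - c * t" and s="{0..}"]) auto
    then have "eventually (\<lambda>m. u < B (s m) \<omega> - c * s m) sequentially"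
      by (rule order_tendstoD(1)) (rule t)
    then obtain m where "u < B (s m) \<omega> - c * s m"
      by (auto simp: eventually_sequentially)
    then show "\<omega> \<in> (\<Union>m. E m)" using \<omega> unfolding E_def s_def by blast
  qed
  have lim: "(\<lambda>m. prob (E m)) \<longlonglongrightarrow> ruin_prob M B c u"
    unfolding ruin_prob_def union
    by (rule finite_Lim_measure_incseq) (use E_sets inc in auto)
  show ?thesis
  proof (rule antisym)
    show "ruin_prob M B c u \<le> exp (- 2 * c * u)"
      by (rule LIMSEQ_le_const2[OF lim]) (use prob_grid_gt_bounds(1)[OF c h u] in \<open>auto simp: E_def\<close>)
    have "(\<lambda>m. gaussian_walk.overshoot_ratio (2 * c\<^sup>2 * h m)) \<longlonglongrightarrow> 1"
      using c h by (intro overshoot_ratio_tendsto tendsto_mult_right_zero h_lim) auto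
    then have "(\<lambda>m. gaussian_walk.overshoot_ratio (2 * c\<^sup>2 * h m) * prob (E m)) \<longlonglongrightarrow> 1 * ruin_prob M B c u"
      by (intro tendsto_mult lim)
    then show "exp (- 2 * c * u) \<le> ruin_prob M B c u"
      by (intro LIMSEQ_le_const[where X="\<lambda>m. gaussian_walk.overshoot_ratio (2 * c\<^sup>2 * h m) * prob (E m)"])
         (use prob_grid_gt_bounds(2)[OF c h u] in \<open>auto simp: E_def\<close>)
  qed
qed

section \<open>Both sides of the asymptotics in terms of the walk\<close>

lemma cumulative_parisian_eq:
  assumes c: "0 < c" and \<delta>: "0 < \<delta>"
  shows "cumulative_parisian M B c \<delta> u k =
    measure (\<Pi>\<^sub>M i\<in>UNIV. gaussian_walk.step (2 * c\<^sup>2 * \<delta>)) {\<omega>. gaussian_walk.exceeds_more k UNIV (2 * c * u) \<omega>}"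
proof -
  define \<eta> where "\<eta> = 2 * c\<^sup>2 * \<delta>"
  interpret gw: gaussian_walk \<eta> by unfold_locales (use c \<delta> in \<open>auto simp: \<eta>_def\<close>)
  let ?x = "2 * c * u"
  \<comment> \<open>The negated form includes infinitely many exceedances, for which
    \<open>num_elems\<close> is infinite. It agrees with \<open>exceeds_more\<close> only almost
    surely.\<close>
  let ?Q = "\<lambda>f :: nat \<Rightarrow> real. \<not> (finite {j \<in> UNIV. ?x < f j} \<and> card {j \<in> UNIV. ?x < f j} \<le> k)"
  have num: "num_elems {t \<in> grid \<delta>. B t \<omega> - c * t > u} > enat k \<longleftrightarrow>
     ?Q (\<lambda>n. 2 * c * B (\<delta> * real n) \<omega> - \<eta> * real n)" for \<omega>
  proof -
    have *: "?x < 2 * c * b - \<eta> * real n \<longleftrightarrow> u < b - c * (\<delta> * real n)" for b n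
    proof -
      have "2 * c * b - \<eta> * real n = 2 * c * (b - c * (\<delta> * real n))"
        by (simp add: algebra_simps power2_eq_square \<eta>_def)
      then show ?thesis using c by (simp add: mult_less_cancel_left_pos)
    qed
    have set: "{t \<in> grid \<delta>. B t \<omega> - c * t > u} =
      (\<lambda>n. \<delta> * real n) ` {j \<in> UNIV. ?x < 2 * c * B (\<delta> * real j) \<omega> - \<eta> * real j}"
      unfolding * by (auto simp: grid_def)
    have inj: "inj_on (\<lambda>n. \<delta> * real n) S" for S
      using \<delta> by (auto simp: inj_on_def)
    show ?thesis
      unfolding set num_elems_def by (simp add: finite_image_iff[OF inj] card_image[OF inj] not_le)
  qed
  have "cumulative_parisian M B c \<delta> u k = prob {\<omega> \<in> space M. ?Q (\<lambda>n. 2 * c * B (\<delta> * real n) \<omega> - \<eta> * real n)}"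
    unfolding cumulative_parisian_def num ..
  also have "\<dots> = gw.P.prob {\<omega>. ?Q (\<lambda>n. gw.walk n \<omega>)}"
  proof (rule prob_grid_eq_prob_walk)
    show "Measurable.pred (\<Pi>\<^sub>M i\<in>(UNIV :: nat set). (borel :: real measure)) ?Q"
      by (intro pred_intros_logic(2) measurable_exceedance_set) auto
  qed (use c \<delta> in \<open>auto simp: \<eta>_def power2_eq_square\<close>)
  also have "\<dots> = gw.P.prob {\<omega>. gw.exceeds_more k UNIV ?x \<omega>}"
  proof (rule gw.P.finite_measure_eq_AE)
    show "AE \<omega> in gw.paths. \<omega> \<in> {\<omega>. ?Q (\<lambda>n. gw.walk n \<omega>)} \<longleftrightarrow> \<omega> \<in> {\<omega>. gw.exceeds_more k UNIV ?x \<omega>}"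
      using gw.AE_finite_exceedances[of ?x] by eventually_elim (auto simp: gw.exceeds_more_def)
    show "{\<omega>. ?Q (\<lambda>n. gw.walk n \<omega>)} \<in> gw.P.events"
      by (intro gw.Collect_in_sets_paths pred_intros_logic(2) measurable_exceedance_set) auto
    show "{\<omega>. gw.exceeds_more k UNIV ?x \<omega>} \<in> gw.P.events"
      by (intro gw.Collect_in_sets_paths) measurable
  qed
  finally show ?thesis by (simp add: \<eta>_def)
qed

lemma berman_integral_eq:
  assumes \<eta>: "0 < \<eta>" and S: "0 \<le> S"
  shows "berman_integral M B \<eta> S k = (LINT x|lborel. exp x *
    measure (\<Pi>\<^sub>M i\<in>UNIV. gaussian_walk.step \<eta>) {\<omega>. gaussian_walk.exceeds_more k {..nat \<lfloor>S / \<eta>\<rfloor>} x \<omega>})"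
proof -
  interpret gw: gaussian_walk \<eta> by unfold_locales (rule \<eta>)
  \<comment> \<open>The index of the last lattice point in \<open>{0..S}\<close>; together with 0
    there are \<open>N + 1\<close> points.\<close>
  define N where "N = nat \<lfloor>S / \<eta>\<rfloor>"
  have pts: "{0..S} \<inter> lattice_pts \<eta> = (\<lambda>n. \<eta> * real n) ` {..N}"
  proof (intro set_eqI iffI)
    fix s assume "s \<in> {0..S} \<inter> lattice_pts \<eta>"
    then obtain j where j: "s = \<eta> * real_of_int j" "0 \<le> s" "s \<le> S"
      by (auto simp: lattice_pts_def)
    then have "0 \<le> j" using \<eta> by (simp add: zero_le_mult_iff)
    moreover have "real_of_int j \<le> S / \<eta>" using j \<eta> by (simp add: field_simps)
    then have "j \<le> \<lfloor>S / \<eta>\<rfloor>" by (simp add: le_floor_iff)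
    ultimately show "s \<in> (\<lambda>n. \<eta> * real n) ` {..N}"
      using j by (intro image_eqI[of _ _ "nat j"]) (auto simp: N_def)
  next
    fix s assume "s \<in> (\<lambda>n. \<eta> * real n) ` {..N}"
    then obtain n where n: "s = \<eta> * real n" "n \<le> N" by auto
    have "real N \<le> S / \<eta>" unfolding N_def using S \<eta> by (simp add: of_nat_nat)
    then have "real n \<le> S / \<eta>" using n by linarith
    then have "s \<le> S" using \<eta> n by (simp add: field_simps)
    moreover have "s = \<eta> * real_of_int (int n)" using n by simp
    ultimately show "s \<in> {0..S} \<inter> lattice_pts \<eta>" 
      using \<eta> n by (auto simp: lattice_pts_def intro!: exI[of _ "int n"])
  qed
  let ?Q = "\<lambda>x f. finite {j \<in> {..N}. x < f j} \<and> k < card {j \<in> {..N}. x < f j}"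
  have sum: "(\<Sum>s\<in>{0..S} \<inter> lattice_pts \<eta>. of_bool (sqrt 2 * B s \<omega> - \<bar>s\<bar> + z > 0)) > k \<longleftrightarrow>
     ?Q (- z) (\<lambda>n. sqrt 2 * B (\<eta> * real n) \<omega> - \<eta> * real n)" for z \<omega>
  proof -
    have inj: "inj_on (\<lambda>n. \<eta> * real n) {..N}" using \<eta> by (auto simp: inj_on_def)
    have "(\<Sum>s\<in>{0..S} \<inter> lattice_pts \<eta>. of_bool (sqrt 2 * B s \<omega> - \<bar>s\<bar> + z > 0)) =
       (\<Sum>n\<le>N. of_bool (- z < sqrt 2 * B (\<eta> * real n) \<omega> - \<eta> * real n) :: nat)"
      unfolding pts sum.reindex[OF inj] using \<eta>
      by (intro sum.cong) (auto simp: abs_mult intro!: arg_cong[where f=of_bool])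
    also have "\<dots> = card {n \<in> {..N}. - z < sqrt 2 * B (\<eta> * real n) \<omega> - \<eta> * real n}"
      by (simp add: sum_of_bool_eq Int_def)
    finally show ?thesis by simp
  qed
  have "\<P>(\<omega> in M. (\<Sum>s\<in>{0..S} \<inter> lattice_pts \<eta>. of_bool (sqrt 2 * B s \<omega> - \<bar>s\<bar> + z > 0)) > k) =
     gw.P.prob {\<omega>. gw.exceeds_more k {..N} (- z) \<omega>}" for z
  proof -
    have "prob {\<omega> \<in> space M. ?Q (- z) (\<lambda>n. sqrt 2 * B (\<eta> * real n) \<omega> - \<eta> * real n)} =
       gw.P.prob {\<omega>. ?Q (- z) (\<lambda>n. gw.walk n \<omega>)}"
    proof (rule prob_grid_eq_prob_walk)
      show "Measurable.pred (\<Pi>\<^sub>M i\<in>(UNIV :: nat set). (borel :: real measure)) (?Q (- z))"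
        by (intro measurable_exceedance_set[where T="\<lambda>c. k < c"]) auto
    qed (use \<eta> in auto)
    then show ?thesis unfolding sum gw.exceeds_more_def .
  qed
  then have "berman_integral M B \<eta> S k = (LINT z|lborel. gw.P.prob {\<omega>. gw.exceeds_more k {..N} (- z) \<omega>} * exp (- z))"
    unfolding berman_integral_def by simp
  \<comment> \<open>The level is \<open>x = - z\<close>, which turns the weight
    \<open>exp (- z)\<close> into \<open>exp x\<close>.\<close>
  also have "\<dots> = (LINT x|lborel. exp x * gw.P.prob {\<omega>. gw.exceeds_more k {..N} x \<omega>})"
    by (subst lborel_integral_real_affine[where c="-1" and t=0]) (auto simp: mult.commute)
  finally show ?thesis by (simp add: N_def)
qed

end

theorem theorem4p2:
  fixes M :: "'a measure" and B :: "real \<Rightarrow> 'a \<Rightarrow> real"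
    and c \<delta> :: real and k :: nat
  assumes "standard_brownian_motion M B" and "c > 0" and "\<delta> > 0"
  shows "((\<lambda>S. berman_integral M B (2 * c\<^sup>2 * \<delta>) S k / S)
            \<longlongrightarrow> berman_const M B (2 * c\<^sup>2 * \<delta>) k) at_top
       \<and> berman_const M B (2 * c\<^sup>2 * \<delta>) k > 0
       \<and> asymp_equiv (\<lambda>u. cumulative_parisian M B c \<delta> u k) at_top
           (\<lambda>u. berman_const M B (2 * c\<^sup>2 * \<delta>) k * ruin_prob M B c u)"
proof -
  interpret standard_brownian_motion M B by fact
  define \<eta> where "\<eta> = 2 * c\<^sup>2 * \<delta>"
  interpret gw: gaussian_walk \<eta> by unfold_locales (use assms in \<open>auto simp: \<eta>_def\<close>)
  define C where "C = gw.kappa k {0<..} / \<eta>"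
  have C: "0 < C" unfolding C_def using gw.kappa_pos gw.eta_pos by simp
  have lim: "((\<lambda>S. berman_integral M B \<eta> S k / S) \<longlongrightarrow> C) at_top"
    unfolding C_def using gw.exceeds_more_integral_asymptotics
    by (rule Lim_transform_eventually)
       (use eventually_ge_at_top[of 0] in \<open>eventually_elim, simp add: berman_integral_eq[OF gw.eta_pos]\<close>)
  \<comment> \<open>\<open>Lim\<close> is identified with \<open>C\<close> only after convergence is
    established, by uniqueness of limits.\<close>
  then have const: "berman_const M B \<eta> k = C"
    unfolding berman_const_def by (intro tendsto_Lim) auto
  \<comment> \<open>At the walk level \<open>2 * c * u\<close> the factor
    \<open>exp (2 * c * u)\<close> is the reciprocal of the ruin probability.\<close>
  have "filterlim (\<lambda>u. 2 * c * u) at_top at_top"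
    using \<open>0 < c\<close> by real_asymp
  then have "((\<lambda>u. exp (2 * c * u) * gw.P.prob {\<omega>. gw.exceeds_more k UNIV (2 * c * u) \<omega>}) \<longlongrightarrow> C) at_top"
    unfolding C_def by (rule filterlim_compose[OF gw.exceeds_more_tail_asymptotics])
  then have "((\<lambda>u. exp (2 * c * u) * gw.P.prob {\<omega>. gw.exceeds_more k UNIV (2 * c * u) \<omega>} / C) \<longlongrightarrow> C / C) at_top"
    using C by (intro tendsto_divide tendsto_const) auto
  then have "((\<lambda>u. exp (2 * c * u) * cumulative_parisian M B c \<delta> u k / C) \<longlongrightarrow> 1) at_top"
    using C by (simp add: cumulative_parisian_eq[OF assms(2,3)] \<eta>_def)
  then have "((\<lambda>u. cumulative_parisian M B c \<delta> u k / (C * ruin_prob M B c u)) \<longlongrightarrow> 1) at_top"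
    by (rule Lim_transform_eventually)
       (use eventually_ge_at_top[of 0] in \<open>eventually_elim, simp add: ruin_prob_eq[OF assms(2)] exp_minus field_simps\<close>)
  then have "asymp_equiv (\<lambda>u. cumulative_parisian M B c \<delta> u k) at_top (\<lambda>u. C * ruin_prob M B c u)"
    by (rule asymp_equivI')
  with lim C const show ?thesis by (simp add: \<eta>_def)
qed

end
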